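(* On the Sierpinski gasket $SG$, let $\{S_j\}_{j\ge0}$ be the fully symmetric orthonormal polynomials and, for each $i\in\{0,1,2\}$, let $\{Q_j^{(i)}\}_{j\ge0}$ be the antisymmetric orthonormal polynomials associated with the boundary point $q_i$. Then the set $$\{\phi_j^{(i)}: i=0,1,2,\ j\ge0\},\qquad \phi_j^{(i)}:=\sqrt{\tfrac23}\,Q_j^{(i)}+\sqrt{\tfrac13}\,S_j,$$ is an orthonormal basis for a subspace $\mathcal P$ of $L^2(SG,\mu)$; that is, $\langle\phi_j^{(i)},\phi_k^{(\ell)}\rangle=\delta_{j,k}\delta_{i,\ell}$ for all $j,k\ge0$ and $i,\ell\in\{0,1,2\}$, and $\mathcal P$ is the closed linear span of this set.
   Context: Sierpinski gasket: let $q_0,q_1,q_2$ be the vertices of an equilateral triangle in $\mathbb{R}^2$ (indices mod 3), $F_i(x)=\tfrac12(x-q_i)+q_i$, and $SG$ the nonempty compact set with $SG=\bigcup_{i=0}^2F_i(SG)$. For a word $w=(w_1,\dots,w_m)$, $F_w=F_{w_1}\circ\cdots\circ F_{w_m}$ and $F_w(SG)$ is a cell of level $m$. $V_0=\{q_0,q_1,q_2\}$ is the boundary, $V_m=\bigcup_iF_iV_{m-1}$, $V_*=\bigcup_mV_m$; for distinct $x,y\in V_m$, $x\sim_m y$ iff $x,y$ lie in a common cell of level $m$. $\mu$ is the probability measure on $SG$ giving mass $3^{-m}$ to each cell of level $m$; all functions are real-valued, $\langle f,g\rangle=\int_{SG}fg\,d\mu$ and $\|f\|_{L^2}^2=\langle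 f,f\rangle$. Laplacian: $\Delta u(x)=\lim_{m\to\infty}\tfrac32 5^m\sum_{y\sim_m x}(u(y)-u(x))$ for $x\in V_*\setminus V_0$; a continuous $u$ is in the domain with $\Delta u=f$ ($f$ continuous on $SG$) if these limits converge uniformly to $f$ on $V_*\setminus V_0$. Derivatives at boundary points: $\partial_nu(q_i)=\lim_m(5/3)^m\big(2u(q_i)-u(F_i^mq_{i+1})-u(F_i^mq_{i-1})\big)$ and $\partial_Tu(q_i)=\lim_m5^m\big(u(F_i^mq_{i+1})-u(F_i^mq_{i-1})\big)$. Monomials: for $n\in\{0,1,2\}$, $j\ge0$, $i\in\{1,2,3\}$, $P_{ji}^{(n)}$ is the unique function with $\Delta^{j+1}P_{ji}^{(n)}=0$ and, for $0\le m\le j$, $\Delta^mP_{ji}^{(n)}(q_n)=\delta_{m,j}\delta_{i,1}$, $\partial_n\Delta^mP_{ji}^{(n)}(q_n)=\delta_{m,j}\delta_{i,2}$, $\partial_T\Delta^mP_{ji}^{(n)}(q_n)=\delta_{m,j}\delta_{i,3}$ (here $\partial_n$ is the normal derivative). For each $i\in\{0,1,2\}$, $\{Q_j^{(i)}\}_{j\ge0}$ is the orthonormal family obtained from $\{P_{j3}^{(i)}\}_{j\ge0}$ by Gram–Schmidt in $L^2(SG,\mu)$, normalized so that the coefficient of $P_{j3}^{(i)}$ in $Q_j^{(i)}$ is positive. With $\rho_j=P_{j1}^{(0)}+P_{j1}^{(1)}+P_{j1}^{(2)}$, $\{S_j\}_{j\ge0}$ is the orthonormal family obtained from $\{\rho_j\}_{j\ge0}$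 by Gram–Schmidt, normalized so that the coefficient of $\rho_j$ in $S_j$ is positive. *)

theory Defs
  imports "HOL-Probability.Probability"
begin

text \<open>
  The three contractions are indexed by the cyclic type \<^typ>\<open>3\<close>, whose elements are
  0, 1, 2 with arithmetic modulo 3; so \<open>i + 1\<close> and \<open>i - 1\<close> are the cyclic neighbours of \<open>i\<close>.
  The gasket \<open>SG\<close> and its measure \<open>\<mu>\<close> are parameters, characterised by the predicates
  \<open>sierpinski_gasket\<close> and \<open>gasket_measure\<close>. Functions on the gasket are functions on the
  plane of which only the values on \<open>SG\<close> matter.
\<close>

definition equilateral :: "(3 \<Rightarrow> real^2) \<Rightarrow> bool" where
  "equilateral q \<longleftrightarrow> (\<exists>s>0. \<forall>i j. i \<noteq> j \<longrightarrow> dist (q i) (q j) = s)"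

definition F :: "(3 \<Rightarrow> real^2) \<Rightarrow> 3 \<Rightarrow> real^2 \<Rightarrow> real^2" where
  "F q i x = (1/2) *\<^sub>R (x - q i) + q i"

definition F_word :: "(3 \<Rightarrow> real^2) \<Rightarrow> 3 list \<Rightarrow> real^2 \<Rightarrow> real^2" where
  "F_word q w = foldr (\<lambda>i g. F q i \<circ> g) w id"

definition sierpinski_gasket :: "(3 \<Rightarrow> real^2) \<Rightarrow> (real^2) set \<Rightarrow> bool" where
  "sierpinski_gasket q SG \<longleftrightarrow>
     SG \<noteq> {} \<and> compact SG \<and> SG = (\<Union>i. F q i ` SG)"

definition cell :: "(3 \<Rightarrow> real^2) \<Rightarrow> (real^2) set \<Rightarrow> 3 list \<Rightarrow> (real^2) set" where
  "cell q SG w = F_word q w ` SG"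

primrec V :: "(3 \<Rightarrow> real^2) \<Rightarrow> nat \<Rightarrow> (real^2) set" where
  "V q 0 = range q"
| "V q (Suc m) = (\<Union>i. F q i ` V q m)"

definition adjacent ::
  "(3 \<Rightarrow> real^2) \<Rightarrow> (real^2) set \<Rightarrow> nat \<Rightarrow> real^2 \<Rightarrow> real^2 \<Rightarrow> bool" where
  "adjacent q SG m x y \<longleftrightarrow>
     x \<in> V q m \<and> y \<in> V q m \<and> x \<noteq> y \<and>
     (\<exists>w. length w = m \<and> x \<in> cell q SG w \<and> y \<in> cell q SG w)"

definition gasket_measure :: "(3 \<Rightarrow> real^2) \<Rightarrow> (real^2) set \<Rightarrow> (real^2) measure \<Rightarrow> bool" where
  "gasket_measure q SG \<mu> \<longleftrightarrow>
     prob_space \<mu> \<and> space \<mu> = SG \<and> sets \<mu> = sets (restrict_space borel SG) \<and>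
     (\<forall>w. measure \<mu> (cell q SG w) = (1/3) ^ length w)"

definition discrete_laplacian ::
  "(3 \<Rightarrow> real^2) \<Rightarrow> (real^2) set \<Rightarrow> nat \<Rightarrow> (real^2 \<Rightarrow> real) \<Rightarrow> real^2 \<Rightarrow> real" where
  "discrete_laplacian q SG m u x =
     3/2 * 5 ^ m * (\<Sum>y | adjacent q SG m x y. u y - u x)"

text \<open>
  \<open>has_laplacian q SG u f\<close>: \<open>u\<close> is in the domain of the Laplacian and its Laplacian is \<open>f\<close>.
  The level-\<open>m\<close> difference quotient is only meaningful at points of \<open>V q m\<close>, so uniform
  convergence means: uniform over \<open>x \<in> V q m - V q 0\<close> as \<open>m \<rightarrow> \<infinity>\<close>.
\<close>

definition has_laplacian ::
  "(3 \<Rightarrow> real^2) \<Rightarrow> (real^2) set \<Rightarrow> (real^2 \<Rightarrow> real) \<Rightarrow> (real^2 \<Rightarrow> real) \<Rightarrow> bool" where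
  "has_laplacian q SG u f \<longleftrightarrow>
     continuous_on SG u \<and> continuous_on SG f \<and>
     (\<forall>\<epsilon>>0. \<exists>N. \<forall>m\<ge>N. \<forall>x \<in> V q m - V q 0.
        \<bar>discrete_laplacian q SG m u x - f x\<bar> < \<epsilon>)"

definition has_normal_derivative ::
  "(3 \<Rightarrow> real^2) \<Rightarrow> (real^2 \<Rightarrow> real) \<Rightarrow> 3 \<Rightarrow> real \<Rightarrow> bool" where
  "has_normal_derivative q u i d \<longleftrightarrow>
     (\<lambda>m. (5/3) ^ m *
        (2 * u (q i) - u ((F q i ^^ m) (q (i + 1))) - u ((F q i ^^ m) (q (i - 1)))))
     \<longlonglongrightarrow> d"

definition has_tangential_derivative ::
  "(3 \<Rightarrow> real^2) \<Rightarrow> (real^2 \<Rightarrow> real) \<Rightarrow> 3 \<Rightarrow> real \<Rightarrow> bool" where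
  "has_tangential_derivative q u i d \<longleftrightarrow>
     (\<lambda>m. 5 ^ m * (u ((F q i ^^ m) (q (i + 1))) - u ((F q i ^^ m) (q (i - 1)))))
     \<longlonglongrightarrow> d"

text \<open>
  \<open>is_monomial q SG n j i P\<close> says that \<open>P\<close> is \<open>P\<^sub>j\<^sub>i\<close> based at \<open>q n\<close>
  (\<open>i \<in> {1,2,3}\<close>); in the definition \<open>D m\<close> is the \<open>m\<close>-th iterated Laplacian of \<open>P\<close>.
  As the Laplacian is determined on \<open>SG\<close>, so are the \<open>D m\<close>.
\<close>

definition is_monomial ::
  "(3 \<Rightarrow> real^2) \<Rightarrow> (real^2) set \<Rightarrow> 3 \<Rightarrow> nat \<Rightarrow> nat \<Rightarrow> (real^2 \<Rightarrow> real) \<Rightarrow> bool" where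
  "is_monomial q SG n j i P \<longleftrightarrow>
     (\<exists>D. D 0 = P \<and>
        (\<forall>m\<le>j. has_laplacian q SG (D m) (D (Suc m))) \<and>
        (\<forall>x\<in>SG. D (Suc j) x = 0) \<and>
        (\<forall>m\<le>j.
           D m (q n) = (if m = j \<and> i = 1 then 1 else 0) \<and>
           has_normal_derivative q (D m) n (if m = j \<and> i = 2 then 1 else 0) \<and>
           has_tangential_derivative q (D m) n (if m = j \<and> i = 3 then 1 else 0)))"

definition l2_functions :: "'a measure \<Rightarrow> ('a \<Rightarrow> real) set" where
  "l2_functions M = {f \<in> borel_measurable M. integrable M (\<lambda>x. (f x)\<^sup>2)}"

definition l2_inner :: "'a measure \<Rightarrow> ('a \<Rightarrow> real) \<Rightarrow> ('a \<Rightarrow> real) \<Rightarrow> real" where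
  "l2_inner M f g = (\<integral>x. f x * g x \<partial>M)"

definition l2_norm :: "'a measure \<Rightarrow> ('a \<Rightarrow> real) \<Rightarrow> real" where
  "l2_norm M f = sqrt (l2_inner M f f)"

text \<open>
  Subsets of \<open>L\<^sup>2\<close> are represented by sets of square-integrable functions. The closed ones
  below contain with a function all its almost-everywhere equal representatives.
\<close>

definition l2_closed_subspace :: "'a measure \<Rightarrow> ('a \<Rightarrow> real) set \<Rightarrow> bool" where
  "l2_closed_subspace M W \<longleftrightarrow>
     W \<subseteq> l2_functions M \<and> (\<lambda>x. 0) \<in> W \<and>
     (\<forall>f\<in>W. \<forall>g\<in>W. (\<lambda>x. f x + g x) \<in> W) \<and>
     (\<forall>c. \<forall>f\<in>W. (\<lambda>x. c * f x) \<in> W) \<and>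
     (\<forall>f\<in>l2_functions M.
        (\<forall>\<epsilon>>0. \<exists>g\<in>W. l2_norm M (\<lambda>x. f x - g x) < \<epsilon>) \<longrightarrow> f \<in> W)"

definition fun_span :: "('a \<Rightarrow> real) set \<Rightarrow> ('a \<Rightarrow> real) set" where
  "fun_span B = {(\<lambda>x. \<Sum>b\<in>T. c b * b x) | T c. finite T \<and> T \<subseteq> B}"

definition l2_closed_span :: "'a measure \<Rightarrow> ('a \<Rightarrow> real) set \<Rightarrow> ('a \<Rightarrow> real) set" where
  "l2_closed_span M B =
     {f \<in> l2_functions M. \<forall>\<epsilon>>0. \<exists>g\<in>fun_span B. l2_norm M (\<lambda>x. f x - g x) < \<epsilon>}"

definition l2_orthonormal_basis ::
  "'a measure \<Rightarrow> ('b \<Rightarrow> 'a \<Rightarrow> real) \<Rightarrow> ('a \<Rightarrow> real) set \<Rightarrow> bool" where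
  "l2_orthonormal_basis M e W \<longleftrightarrow>
     range e \<subseteq> l2_functions M \<and>
     (\<forall>a b. l2_inner M (e a) (e b) = (if a = b then 1 else 0)) \<and>
     W = l2_closed_span M (range e)"

text \<open>
  Gram--Schmidt. The coefficient of \<open>f j\<close> in the \<open>j\<close>-th output is the reciprocal of a norm,
  hence positive whenever \<open>f 0, \<dots>, f j\<close> are linearly independent in \<open>L\<^sup>2\<close>.
\<close>

fun gram_schmidt :: "'a measure \<Rightarrow> (nat \<Rightarrow> 'a \<Rightarrow> real) \<Rightarrow> nat \<Rightarrow> 'a \<Rightarrow> real" where
  "gram_schmidt M f j =
     (let v = (\<lambda>x. f j x - (\<Sum>k<j. l2_inner M (f j) (gram_schmidt M f k) * gram_schmidt M f k x))
      in (\<lambda>x. v x / l2_norm M v))"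

declare gram_schmidt.simps [simp del]

text \<open>Here \<open>P n j i\<close> stands for the monomial \<open>P\<^sub>j\<^sub>i\<close> based at \<open>q n\<close>.\<close>

definition antisymmetric_polynomial ::
  "(real^2) measure \<Rightarrow> (3 \<Rightarrow> nat \<Rightarrow> nat \<Rightarrow> real^2 \<Rightarrow> real) \<Rightarrow> 3 \<Rightarrow> nat \<Rightarrow> real^2 \<Rightarrow> real" where
  "antisymmetric_polynomial \<mu> P i = gram_schmidt \<mu> (\<lambda>j. P i j 3)"

definition \<rho> :: "(3 \<Rightarrow> nat \<Rightarrow> nat \<Rightarrow> real^2 \<Rightarrow> real) \<Rightarrow> nat \<Rightarrow> real^2 \<Rightarrow> real" where
  "\<rho> P j x = P 0 j 1 x + P 1 j 1 x + P 2 j 1 x"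

definition symmetric_polynomial ::
  "(real^2) measure \<Rightarrow> (3 \<Rightarrow> nat \<Rightarrow> nat \<Rightarrow> real^2 \<Rightarrow> real) \<Rightarrow> nat \<Rightarrow> real^2 \<Rightarrow> real" where
  "symmetric_polynomial \<mu> P = gram_schmidt \<mu> (\<rho> P)"

definition \<phi> ::
  "(real^2) measure \<Rightarrow> (3 \<Rightarrow> nat \<Rightarrow> nat \<Rightarrow> real^2 \<Rightarrow> real) \<Rightarrow> 3 \<Rightarrow> nat \<Rightarrow> real^2 \<Rightarrow> real" where
  "\<phi> \<mu> P i j x =
     sqrt (2/3) * antisymmetric_polynomial \<mu> P i j x + sqrt (1/3) * symmetric_polynomial \<mu> P j x"

end

theory Submission
  imports Defs
begin

text \<open>
  Each \<open>P\<^sub>j\<^sub>3\<close> is antisymmetric under the reflection fixing its base point, and reflections permute the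
  three families up to sign. Hence the sum of \<open>P\<^sub>j\<^sub>3\<close> over the three base points is alternating. An
  alternating function vanishes at the vertices, so by the uniqueness of harmonic functions and
  induction on \<open>j\<close> the sum is zero. As the measure is invariant under reflections, Gram--Schmidt
  respects these relations: the three \<open>Q\<^sub>k\<close> add up to zero, and the reflection fixing the base point
  of a given \<open>Q\<^sub>j\<close> shows that it has the same inner product with the \<open>Q\<^sub>k\<close> of the two other base
  points, namely \<open>-1/2\<close> times the Kronecker delta of \<open>j\<close> and \<open>k\<close>. Since \<open>S\<^sub>k\<close> is
  symmetric, it is orthogonal to all \<open>Q\<^sub>j\<close>, and \<open>2/3 * (-1/2) + 1/3 = 0\<close>.

  Uniqueness rests on an exact estimate: the supremum of the level-\<open>m\<close> discrete Laplacian is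
  nondecreasing in \<open>m\<close>, so a function with zero Laplacian is graph harmonic on every level.
\<close>

subsection \<open>Cells and vertices\<close>

text \<open>The weights are forced by geometry. In each degree the three \<open>Q\<close> are unit
  vectors at mutual angles of 120 degrees in a plane. Adding a common multiple of a unit vector
  orthogonal to that plane lifts them to an orthonormal frame: weights \<open>a\<close> and
  \<open>b\<close> must satisfy \<open>a^2 + b^2 = 1\<close> and \<open>b^2 - a^2 / 2 = 0\<close>,
  hence \<open>a^2 = 2/3\<close> and \<open>b^2 = 1/3\<close>.

  Two obstacles shape the rest. The hypotheses speak of limits of difference quotients, whereas
  uniqueness of monomials needs control on each finite graph, and for that an exact account of the
  cells meeting at a vertex. As the gasket is known only as a compact fixed point, such incidence
  questions are settled by integer barycentric coordinates, where vertices of one level are compared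
  by arithmetic and parity. Likewise \<open>\<mu>\<close> is given only through the masses of cells,
  so its symmetry is derived from Riemann sums indexed by words, which a reflection
  permutes.\<close>

lemma three_cases: "(x::3) = 0 \<or> x = 1 \<or> x = 2"
  using exhaust_3[of x] by auto

lemma three_around: "(i::3) = j \<or> i = j + 1 \<or> i = j - 1"
  using three_cases[of i] three_cases[of j] by auto

lemma three_distinct [simp]:
  "(j::3) \<noteq> j + 1" "j \<noteq> j - 1" "j + 1 \<noteq> j - 1" "j + 1 \<noteq> j" "j - 1 \<noteq> j" "j - 1 \<noteq> j + 1"
  using three_cases[of j] by auto

lemma sum_around: "(\<Sum>l\<in>UNIV. f l) = f j + f (j + 1) + f (j - 1)" for j :: 3
proof -
  have [simp]: "(3::3) = 0" "(-1::3) = 2" by simp_all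
  show ?thesis using three_cases[of j] by (elim disjE) (simp_all add: sum_3 ac_simps)
qed

lemma sum_three: "(\<Sum>l\<in>UNIV. f l) = f 0 + f 1 + f (2::3)"
proof -
  have [simp]: "(-1::3) = 2" by simp
  show ?thesis using sum_around[of f 0] by simp
qed

lemma third_index:
  assumes "(i::3) \<noteq> l"
  obtains t where "t \<noteq> i" "t \<noteq> l"
    "\<And>f :: 3 \<Rightarrow> 'a::comm_monoid_add. (\<Sum>a\<in>UNIV. f a) = f i + f l + f t"
proof -
  \<comment> \<open>Since 0 + 1 + 2 = 0 modulo 3, this is the missing index.\<close>
  define t where "t = - i - l"
  have "t \<noteq> i" "t \<noteq> l" "UNIV = {i, l, t}"
    using assms three_cases[of i] three_cases[of l] unfolding t_def UNIV_3 by auto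
  moreover have "(\<Sum>a\<in>{i, l, t}. f a) = f i + f l + f t" for f :: "3 \<Rightarrow> 'a"
    using assms calculation(1,2) by (simp add: ac_simps eq_commute)
  ultimately show thesis using that by metis
qed

section \<open>Words and their integer coordinates\<close>

lemma card_words: "card {w :: 3 list. length w = m} = 3 ^ m"
  using card_lists_length_eq[of "UNIV :: 3 set" m] by simp

lemma finite_words [simp]: "finite {w :: 3 list. length w = m}"
  using finite_lists_length_eq[of "UNIV :: 3 set" m] by simp

text \<open>\<open>num w i\<close> reads \<open>w\<close> as a binary number in which the digit 1
  marks the letter \<open>i\<close>. The first letter is the outermost contraction and therefore
  carries the highest power of 2. Up to the scale \<open>2 ^ length w\<close>, these numbers are the
  translation part of \<open>F_word q w\<close>.\<close>

primrec num :: "3 list \<Rightarrow> 3 \<Rightarrow> nat" where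
  "num [] i = 0"
| "num (a # w) i = num w i + (if a = i then 2 ^ length w else 0)"

lemma num_snoc: "num (w @ [a]) i = 2 * num w i + (if a = i then 1 else 0)"
  by (induction w) auto

lemma sum_num: "(\<Sum>i\<in>UNIV. num w i) + 1 = 2 ^ length w"
  by (induction w) (auto simp: sum.distrib)

text \<open>The parity of \<open>num w i\<close> tells whether \<open>i\<close> is the last letter.
  Removing that letter halves the numbers, so the word is recovered from the back.\<close>

lemma num_inj: "length w = length w' \<Longrightarrow> (\<And>i. num w i = num w' i) \<Longrightarrow> w = w'"
proof (induction w arbitrary: w' rule: rev_induct)
  case (snoc a w)
  then obtain b v where w': "w' = v @ [b]"
    by (metis length_append_singleton length_Suc_conv_rev)
  have *: "2 * num w i + (if a = i then 1 else 0) = 2 * num v i + (if b = i then 1 else 0)" for i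
    using snoc.prems(2)[of i] by (simp add: w' num_snoc)
  have "a = b"
  proof (rule ccontr)
    assume "a \<noteq> b"
    with *[of a] have "2 * num w a + 1 = 2 * num v a" by simp
    then show False by presburger
  qed
  with * have "num w i = num v i" for i using *[of i] by auto
  with snoc \<open>a = b\<close> show ?case by (simp add: w')
qed simp

lemma F_word_Nil [simp]: "F_word q [] x = x"
  by (simp add: F_word_def)

lemma F_word_Cons [simp]: "F_word q (i # w) x = F q i (F_word q w x)"
  by (simp add: F_word_def)

lemma F_word_append: "F_word q (v @ w) x = F_word q v (F_word q w x)"
  by (induction v) auto

lemma F_word_replicate: "F_word q (replicate m i) x = (F q i ^^ m) x"
  by (induction m) auto

lemma F_eq: "F q i x = (1/2) *\<^sub>R (x + q i)"
proof -
  have "(1/2) *\<^sub>R (q i) + (1/2) *\<^sub>R (q i) = q i" by (simp flip: scaleR_add_left)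
  then show ?thesis unfolding F_def by (simp add: algebra_simps)
qed

lemma F_vertex [simp]: "F q i (q i) = q i"
  by (simp add: F_def)

lemma vertex_funpow [simp]: "(F q i ^^ m) (q i) = q i"
  by (induction m) auto

lemma F_word_eq:
  "F_word q w x = (1/2) ^ length w *\<^sub>R (x + (\<Sum>i\<in>UNIV. real (num w i) *\<^sub>R q i))"
proof (induction w)
  case (Cons a w)
  have "(\<Sum>i\<in>UNIV. real (num (a # w) i) *\<^sub>R q i)
      = (\<Sum>i\<in>UNIV. real (num w i) *\<^sub>R q i) + 2 ^ length w *\<^sub>R q a"
  proof -
    have "real (num (a # w) i) *\<^sub>R q i = real (num w i) *\<^sub>R q i + (if a = i then 2 ^ length w *\<^sub>R q i else 0)" for i
      by (simp add: algebra_simps)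
    then show ?thesis by (simp add: sum.distrib)
  qed
  then show ?case by (simp add: F_eq Cons algebra_simps power_divide)
qed simp

lemma V_eq: "V q m = {F_word q w (q j) | w j. length w = m}"
proof (induction m)
  case (Suc m)
  have "V q (Suc m) = {F q i (F_word q w (q j)) | i w j. length w = m}"
    using Suc by auto
  also have "\<dots> = {F_word q w (q j) | w j. length w = Suc m}"
    by (force simp: length_Suc_conv)
  finally show ?case .
qed auto

lemma V_I: "length w = m \<Longrightarrow> F_word q w (q j) \<in> V q m"
  unfolding V_eq by blast

lemma V_E:
  assumes "x \<in> V q m"
  obtains w j where "length w = m" "x = F_word q w (q j)"
  using assms unfolding V_eq by blast

lemma V_mono_Suc: "V q m \<subseteq> V q (Suc m)"
proof
  fix x assume "x \<in> V q m"
  then obtain w j where "length w = m" "x = F_word q w (q j)" by (rule V_E)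
  then show "x \<in> V q (Suc m)" using V_I[of "w @ [j]" "Suc m" q j] by (simp add: F_word_append)
qed

lemma V_mono: "m \<le> n \<Longrightarrow> V q m \<subseteq> V q n"
  by (rule lift_Suc_mono_le[of "V q"]) (use V_mono_Suc in auto)

lemma dist_F: "dist (F q i x) (F q i y) = dist x y / 2"
proof -
  have "F q i x - F q i y = (1/2) *\<^sub>R (x - y)" by (simp add: F_eq algebra_simps)
  then show ?thesis by (simp add: dist_norm)
qed

lemma dist_F_word: "dist (F_word q w x) (F_word q w y) = dist x y / 2 ^ length w"
  by (induction w) (auto simp: dist_F)

lemma continuous_F_word: "continuous_on S (F_word q w)"
  unfolding F_word_eq[abs_def] by (intro continuous_intros)

section \<open>Barycentric coordinates on the gasket\<close>

locale gasket =
  fixes q :: "3 \<Rightarrow> real^2" and SG :: "(real^2) set"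
  assumes equilateral: "equilateral q"
    and gasket: "sierpinski_gasket q SG"
begin

definition side :: real where "side = dist (q 0) (q 1)"

lemma dist_vertices: "i \<noteq> j \<Longrightarrow> dist (q i) (q j) = side"
  and side_pos: "side > 0"
proof -
  obtain s where s: "s > 0" "\<And>i j. i \<noteq> j \<Longrightarrow> dist (q i) (q j) = s"
    using equilateral unfolding equilateral_def by blast
  then have "side = s" by (simp add: side_def)
  with s show "i \<noteq> j \<Longrightarrow> dist (q i) (q j) = side" "side > 0" by auto
qed

text \<open>The affine function that is 1 at \<open>q i\<close> and 0 at the other two vertices. For
  the edge vectors \<open>a\<close>, \<open>b\<close> leaving \<open>q i\<close> one has
  \<open>a \<bullet> (a + b) = 3/2 * side\<^sup>2\<close>, which explains the factor.\<close>

definition bary :: "3 \<Rightarrow> real^2 \<Rightarrow> real" where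
  "bary i x = 1 - 2 / (3 * side\<^sup>2) * ((x - q i) \<bullet> ((q (i + 1) - q i) + (q (i - 1) - q i)))"

lemma bary_vertex: "bary i (q j) = (if i = j then 1 else 0)"
proof -
  define a where "a = q (i + 1) - q i"
  define b where "b = q (i - 1) - q i"
  have "norm a = side" "norm b = side" "norm (a - b) = side"
    unfolding a_def b_def by (simp_all add: dist_vertices flip: dist_norm)
  then have aa: "a \<bullet> a = side\<^sup>2" "b \<bullet> b = side\<^sup>2" and ab: "(a - b) \<bullet> (a - b) = side\<^sup>2"
    by (simp_all add: dot_square_norm)
  have ab': "a \<bullet> b = side\<^sup>2 / 2"
    using ab aa by (simp add: inner_diff inner_commute)
  consider "j = i" | "j = i + 1" | "j = i - 1" using three_around by blast
  then show ?thesis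
  proof cases
    case 2
    then have "bary i (q j) = 1 - 2 / (3 * side\<^sup>2) * (a \<bullet> (a + b))"
      by (simp add: bary_def a_def b_def)
    then show ?thesis using 2 side_pos by (simp add: inner_add aa ab' field_simps)
  next
    case 3
    then have "bary i (q j) = 1 - 2 / (3 * side\<^sup>2) * (b \<bullet> (a + b))"
      by (simp add: bary_def a_def b_def)
    moreover have "i \<noteq> j" using 3 by simp
    ultimately show ?thesis using side_pos by (simp add: inner_add aa ab' inner_commute[of b a] field_simps)
  qed (simp add: bary_def)
qed

lemma bary_F: "bary i (F q j x) = (bary i x + (if i = j then 1 else 0)) / 2"
proof -
  have "bary i (F q j x) = (bary i x + bary i (q j)) / 2"
    unfolding bary_def F_eq by (simp add: inner_diff inner_add algebra_simps)
  then show ?thesis by (simp add: bary_vertex)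
qed

lemma bary_F_word: "bary i (F_word q w x) = (real (num w i) + bary i x) / 2 ^ length w"
  by (induction w) (auto simp: bary_F field_simps)

lemma continuous_bary: "continuous_on S (bary i)"
  unfolding bary_def by (intro continuous_intros)

lemma SG_nonempty: "SG \<noteq> {}" and compact_SG: "compact SG" and SG_eq: "SG = (\<Union>i. F q i ` SG)"
  using gasket unfolding sierpinski_gasket_def by auto

lemma F_SG: "x \<in> SG \<Longrightarrow> F q i x \<in> SG"
  using SG_eq by blast

lemma F_word_SG: "x \<in> SG \<Longrightarrow> F_word q w x \<in> SG"
  by (induction w) (auto intro: F_SG)

text \<open>Iterating the contraction \<open>F q i\<close> on any point of the gasket converges to
  its fixed point \<open>q i\<close>, and \<open>SG\<close> is closed.\<close>

lemma vertex_SG: "q i \<in> SG"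
proof -
  obtain x where x: "x \<in> SG" using SG_nonempty by auto
  have "(\<lambda>m. (F q i ^^ m) x) \<longlonglongrightarrow> q i"
  proof (subst tendsto_dist_iff)
    have d: "dist ((F q i ^^ m) x) (q i) = dist x (q i) / 2 ^ m" for m
      using dist_F_word[of q "replicate m i" x "q i"] by (simp add: F_word_replicate vertex_funpow)
    have "(\<lambda>m. dist x (q i) * (1/2) ^ m) \<longlonglongrightarrow> 0"
      by (rule tendsto_mult_right_zero[OF LIMSEQ_power_zero]) simp
    then show "(\<lambda>m. dist ((F q i ^^ m) x) (q i)) \<longlonglongrightarrow> 0"
      unfolding d by (simp add: power_divide)
  qed
  moreover have "(F q i ^^ m) x \<in> SG" for m
    using F_word_SG[OF x] by (simp flip: F_word_replicate)
  ultimately show ?thesis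
    using closed_sequentially[OF compact_imp_closed[OF compact_SG], of "\<lambda>m. (F q i ^^ m) x"] by simp
qed

lemma V_SG: "V q m \<subseteq> SG"
  using vertex_SG F_word_SG by (auto elim!: V_E)

text \<open>At a minimum point \<open>z = F q j y\<close> the coordinate is at least half of the
  coordinate of \<open>y\<close>, hence at least half of the minimum itself. So the minimum cannot
  be negative.\<close>

lemma bary_nonneg: "x \<in> SG \<Longrightarrow> bary i x \<ge> 0"
proof -
  obtain z where z: "z \<in> SG" "\<And>y. y \<in> SG \<Longrightarrow> bary i z \<le> bary i y"
    using continuous_attains_inf[OF compact_SG SG_nonempty continuous_bary] by metis
  obtain j y where "y \<in> SG" "z = F q j y" using SG_eq z(1) by blast
  then have "bary i z \<ge> bary i z / 2"
    using z(2)[of y] by (auto simp: bary_F split: if_splits)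
  then show "x \<in> SG \<Longrightarrow> bary i x \<ge> 0" using z(2)[of x] by linarith
qed

lemma SG_in_cell:
  assumes "x \<in> SG" obtains w where "length w = m" "x \<in> cell q SG w"
proof -
  have "\<exists>w. length w = m \<and> x \<in> cell q SG w" using assms
  proof (induction m arbitrary: x)
    case (Suc m)
    obtain j y where y: "y \<in> SG" "x = F q j y" using SG_eq Suc(2) by blast
    then obtain w where "length w = m" "y \<in> cell q SG w" using Suc.IH by blast
    then show ?case using y by (intro exI[of _ "j # w"]) (auto simp: cell_def)
  qed (simp add: cell_def)
  then show thesis using that by blast
qed

lemma cell_subset: "cell q SG w \<subseteq> SG"
  using F_word_SG by (auto simp: cell_def)

lemma compact_cell: "compact (cell q SG w)"
  unfolding cell_def by (intro compact_continuous_image continuous_F_word compact_SG)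

text \<open>Both corners have coordinates with denominator \<open>2 ^ length w\<close> and integer
  numerators, so equality of points becomes equality of integer triples.\<close>

lemma F_word_eq_iff:
  assumes "length w = length w'"
  shows "F_word q w (q j) = F_word q w' (q j') \<longleftrightarrow>
    (\<forall>i. num w i + (if i = j then 1 else 0) = num w' i + (if i = j' then 1 else 0))"
    (is "?L \<longleftrightarrow> ?R")
proof
  assume ?L
  then have "bary i (F_word q w (q j)) = bary i (F_word q w' (q j'))" for i by simp
  then have *: "real (num w i) + (if i = j then 1 else 0) = real (num w' i) + (if i = j' then 1 else 0)" for i
    using assms by (simp add: bary_F_word bary_vertex)
  have "num w i + (if i = j then 1 else 0) = num w' i + (if i = j' then 1 else 0)" for i
    using *[of i] by (auto split: if_splits)
  then show ?R by blast
next
  assume R: ?R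
  have "q j + (\<Sum>i\<in>UNIV. real (num w i) *\<^sub>R q i)
      = (\<Sum>i\<in>UNIV. real (num w i + (if i = j then 1 else 0)) *\<^sub>R q i)" for w j
  proof -
    have "real (num w i + (if i = j then 1 else 0)) *\<^sub>R q i
        = (if i = j then q i else 0) + real (num w i) *\<^sub>R q i" for i
      by (simp add: algebra_simps)
    then show ?thesis by (simp add: sum.distrib)
  qed
  then show ?L by (simp only: F_word_eq assms R)
qed

text \<open>The coordinates of the vertex dominate those of the word \<open>w'\<close> because the
  point \<open>y\<close> in between has nonnegative coordinates. The totals differ by 1 and all
  numbers are integers, so exactly one coordinate exceeds, by 1, and it names the corner. This makes
  adjacency, which is stated with cells as point sets, purely combinatorial.\<close>

lemma vertex_in_cell:
  assumes "length w = length w'" "F_word q w (q j) \<in> cell q SG w'"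
  obtains t where "F_word q w (q j) = F_word q w' (q t)"
proof -
  define n where "n i = num w i + (if i = j then 1 else 0)" for i
  obtain y where y: "y \<in> SG" "F_word q w (q j) = F_word q w' y" using assms(2) by (auto simp: cell_def)
  have le: "num w' i \<le> n i" for i
  proof -
    have "bary i (F_word q w (q j)) = bary i (F_word q w' y)" using y by simp
    then have "real (n i) = real (num w' i) + bary i y"
      using assms(1) by (simp add: bary_F_word bary_vertex n_def split: if_splits)
    then show ?thesis using bary_nonneg[OF y(1), of i] by linarith
  qed
  have "(\<Sum>i\<in>UNIV. n i) = (\<Sum>i\<in>UNIV. num w' i) + 1"
    unfolding n_def sum.distrib using sum_num[of w] sum_num[of w'] assms(1) by simp
  then have "(\<Sum>i\<in>UNIV. n i - num w' i) = 1"
    using le by (subst sum_subtractf_nat) auto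
  then obtain t where "n t - num w' t = 1" "\<And>i. i \<noteq> t \<Longrightarrow> n i - num w' i = 0"
    by (subst (asm) sum_eq_1_iff) auto
  then have "n i = num w' i + (if i = t then 1 else 0)" for i
    using le[of i] le[of t] by (cases "i = t") fastforce+
  then have "F_word q w (q j) = F_word q w' (q t)"
    using assms(1) by (subst F_word_eq_iff) (auto simp: n_def)
  then show thesis using that by blast
qed

lemma inj_vertices: "q i = q j \<longleftrightarrow> i = j"
proof
  assume "q i = q j"
  then have "bary i (q i) = bary i (q j)" by simp
  then show "i = j" by (simp add: bary_vertex split: if_splits)
qed simp

lemma F_word_inj: "F_word q w x = F_word q w y \<longleftrightarrow> x = y"
proof
  assume "F_word q w x = F_word q w y"
  then show "x = y" using dist_F_word[of q w x y] by simp
qed simp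

text \<open>The approximating points are edge midpoints inside small cells, not arbitrary vertices:
  they avoid the boundary, where the Laplacian is not prescribed.\<close>

lemma dense_interior:
  assumes "x \<in> SG" "e > 0"
  obtains w i l where "i \<noteq> l" "dist (F_word q w (F q i (q l))) x < e"
proof -
  obtain B where B: "\<And>y z. y \<in> SG \<Longrightarrow> z \<in> SG \<Longrightarrow> dist y z \<le> B"
    using compact_imp_bounded[OF compact_SG] diameter_bounded_bound[of SG] by metis
  obtain m where m: "B / e < 2 ^ m" using real_arch_pow[of 2 "B/e"] by auto
  obtain w where w: "length w = m" "x \<in> cell q SG w" using SG_in_cell[OF assms(1)] by metis
  then obtain y where y: "y \<in> SG" "x = F_word q w y" by (auto simp: cell_def)
  have "dist (F_word q w (F q 0 (q 1))) x \<le> B / 2 ^ m"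
    unfolding y(2) dist_F_word w(1) by (intro divide_right_mono B y F_SG vertex_SG) auto
  also have "\<dots> < e" using m assms(2) by (simp add: field_simps)
  finally show thesis using that[of 0 1 w] by simp
qed

end

subsection \<open>Graph harmonic functions\<close>

context gasket begin

text \<open>Records every cell of level \<open>m\<close> having \<open>x\<close> as a corner,
  together with the index of that corner. Sums over neighbours can then be grouped by cells, which
  refine well from one level to the next.\<close>

definition corners :: "nat \<Rightarrow> real^2 \<Rightarrow> (3 list \<times> 3) set" where
  "corners m x = {(w, j). length w = m \<and> F_word q w (q j) = x}"

definition cell_sum :: "(real^2 \<Rightarrow> real) \<Rightarrow> 3 list \<Rightarrow> real^2 \<Rightarrow> real" where
  "cell_sum u w x = (\<Sum>l\<in>UNIV. u (F_word q w (q l)) - u x)"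

definition graph_sum :: "nat \<Rightarrow> (real^2 \<Rightarrow> real) \<Rightarrow> real^2 \<Rightarrow> real" where
  "graph_sum m u x = (\<Sum>y | adjacent q SG m x y. u y - u x)"

lemma finite_corners [simp]: "finite (corners m x)"
  by (rule finite_subset[of _ "{w. length w = m} \<times> UNIV"]) (auto simp: corners_def)

lemma adjacent_iff:
  assumes "x \<in> V q m"
  shows "adjacent q SG m x y \<longleftrightarrow>
    (\<exists>(w, j)\<in>corners m x. \<exists>l. l \<noteq> j \<and> y = F_word q w (q l))"
proof
  assume adj: "adjacent q SG m x y"
  then obtain w where w: "length w = m" "x \<in> cell q SG w" "y \<in> cell q SG w"
    and V: "x \<in> V q m" "y \<in> V q m" "x \<noteq> y"
    by (auto simp: adjacent_def)
  obtain j where j: "x = F_word q w (q j)"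
    using w V vertex_in_cell by (metis V_E)
  obtain l where l: "y = F_word q w (q l)"
    using w V vertex_in_cell by (metis V_E)
  show "\<exists>(w, j)\<in>corners m x. \<exists>l. l \<noteq> j \<and> y = F_word q w (q l)"
    using V j l w(1) by (intro bexI[of _ "(w, j)"]) (auto simp: corners_def)
next
  assume "\<exists>(w, j)\<in>corners m x. \<exists>l. l \<noteq> j \<and> y = F_word q w (q l)"
  then obtain w j l where "length w = m" "x = F_word q w (q j)" "l \<noteq> j" "y = F_word q w (q l)"
    by (auto simp: corners_def)
  then show "adjacent q SG m x y"
    unfolding adjacent_def cell_def
    by (auto simp: F_word_inj inj_vertices intro!: V_I imageI vertex_SG)
qed

text \<open>Two different cells of one level share at most one vertex, so each neighbour of
  \<open>x\<close> is reached through only one cell and no edge is counted twice. In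
  \<open>cell_sum\<close> the corner \<open>x\<close> itself contributes zero.\<close>

lemma graph_sum_eq:
  assumes "x \<in> V q m"
  shows "graph_sum m u x = (\<Sum>(w, j)\<in>corners m x. cell_sum u w x)"
proof -
  let ?A = "SIGMA p:corners m x. {l. l \<noteq> snd p}"
  let ?h = "\<lambda>((w, j), l). F_word q w (q l)"
  have "inj_on ?h ?A"
  proof (rule inj_onI)
    fix a b assume a: "a \<in> ?A" and b: "b \<in> ?A" and eq: "?h a = ?h b"
    obtain w j l where A: "a = ((w, j), l)" by (metis surj_pair)
    obtain w' j' l' where B: "b = ((w', j'), l')" by (metis surj_pair)
    have len: "length w = length w'" and "F_word q w (q j) = F_word q w' (q j')"
      and "F_word q w (q l) = F_word q w' (q l')" and ne: "l \<noteq> j" "l' \<noteq> j'"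
      using a b eq by (auto simp: A B corners_def)
    then have *: "\<And>i. num w i + (if i = j then 1 else 0) = num w' i + (if i = j' then 1 else 0)"
      "\<And>i. num w i + (if i = l then 1 else 0) = num w' i + (if i = l' then 1 else 0)"
      by (auto simp only: F_word_eq_iff[OF len])
    \<comment> \<open>Subtracting the two families of identities leaves a difference of two unit
      vectors, which determines both indices since \<open>l \<noteq> j\<close>.\<close>
    have "l = l'" using *[of l] ne by (auto split: if_splits)
    with * have "num w i = num w' i" for i using *(2)[of i] by simp
    then have "w = w'" using num_inj len by blast
    moreover have "j = j'" using *(1)[of j] \<open>w = w'\<close> by (auto split: if_splits)
    ultimately show "a = b" using \<open>l = l'\<close> by (simp add: A B)
  qed
  moreover have "?h ` ?A = {y. adjacent q SG m x y}"
    by (force simp: adjacent_iff[OF assms] split_beta)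
  ultimately have "graph_sum m u x = (\<Sum>a\<in>?A. u (?h a) - u x)"
    unfolding graph_sum_def by (simp add: sum.reindex flip: \<open>?h ` ?A = _\<close>)
  also have "\<dots> = (\<Sum>p\<in>corners m x. \<Sum>l | l \<noteq> snd p. u (F_word q (fst p) (q l)) - u x)"
    by (subst sum.Sigma) (auto intro!: sum.cong)
  also have "\<dots> = (\<Sum>p\<in>corners m x. cell_sum u (fst p) x)"
    unfolding cell_sum_def
    by (intro sum.cong sum.mono_neutral_left) (auto simp: corners_def)
  finally show ?thesis by (simp add: split_beta)
qed

lemma F_vertex_commute: "F q i (q l) = F q l (q i)"
  by (simp add: F_eq add.commute)

lemma snoc_corner_eq_iff:
  assumes "length v = length w"
  shows "F_word q (v @ [a]) (q b) = F_word q (w @ [i]) (q l) \<longleftrightarrow>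
    (\<forall>p. 2 * num v p + (if a = p then 1 else 0) + (if p = b then 1 else 0)
      = 2 * num w p + (if i = p then 1 else 0) + (if p = l then 1 else 0))"
  using assms by (subst F_word_eq_iff) (simp_all add: num_snoc)

text \<open>The integer coordinates of this edge midpoint are odd exactly at \<open>i\<close> and
  \<open>l\<close>. Parity forces the last letter and the corner of any representation to be
  \<open>i\<close> and \<open>l\<close> in some order; the remaining even part then determines the
  word.\<close>

lemma corners_junction:
  assumes "i \<noteq> l"
  shows "corners (Suc (length w)) (F_word q (w @ [i]) (q l)) = {(w @ [i], l), (w @ [l], i)}"
proof (intro equalityI subsetI)
  fix p assume "p \<in> corners (Suc (length w)) (F_word q (w @ [i]) (q l))"
  then obtain v a b where p: "p = (v @ [a], b)" and len: "length v = length w"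
    and eq: "F_word q (v @ [a]) (q b) = F_word q (w @ [i]) (q l)"
    by (auto simp: corners_def length_Suc_conv_rev)
  note * = eq[unfolded snoc_corner_eq_iff[OF len], rule_format]
  have odd: "(if a = p then 1 else 0) + (if p = b then 1 else 0) = (1::nat)" if "p = i \<or> p = l" for p
  proof -
    have "2 * num v p + (if a = p then 1 else 0) + (if p = b then 1 else 0) = 2 * num w p + 1"
      using *[of p] that assms by auto
    then show ?thesis by (auto split: if_splits) presburger+
  qed
  have ab: "a = i \<and> b = l \<or> a = l \<and> b = i"
  proof (cases "a = i")
    case True
    then have "a \<noteq> l" using assms by simp
    then show ?thesis using True odd[of l] by (simp split: if_splits)
  next
    case False
    then have "i = b" using odd[of i] by (simp split: if_splits)
    then show ?thesis using odd[of l] assms by (simp split: if_splits)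
  qed
  then have "num v p = num w p" for p using *[of p] by (elim disjE conjE) (simp_all split: if_splits)
  then have "v = w" using num_inj len by blast
  with ab p show "p \<in> {(w @ [i], l), (w @ [l], i)}" by auto
qed (auto simp: corners_def F_word_append F_vertex_commute)

text \<open>A vertex of the coarser level has a representation \<open>(v @ [j], j)\<close> whose
  last letter repeats the corner, and neither representation of a midpoint has this form.\<close>

lemma junction_new:
  assumes "i \<noteq> l"
  shows "F_word q (w @ [i]) (q l) \<notin> V q (length w)"
proof
  assume "F_word q (w @ [i]) (q l) \<in> V q (length w)"
  then obtain v j where "length v = length w" "F_word q (v @ [j]) (q j) = F_word q (w @ [i]) (q l)"
    by (auto elim!: V_E simp: F_word_append)
  then have "(v @ [j], j) \<in> corners (Suc (length w)) (F_word q (w @ [i]) (q l))"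
    by (simp add: corners_def)
  with assms show False by (auto simp: corners_junction)
qed

lemma junction_interior:
  assumes "i \<noteq> l"
  shows "F_word q (w @ [i]) (q l) \<in> V q (Suc (length w)) - V q 0"
  using junction_new[OF assms, of w] V_mono[of 0 "length w" q] by (blast intro: V_I length_append_singleton)

lemma corners_Suc:
  assumes "x \<in> V q m"
  shows "corners (Suc m) x = (\<lambda>(w, j). (w @ [j], j)) ` corners m x"
proof (intro equalityI subsetI)
  fix p assume "p \<in> corners (Suc m) x"
  then obtain v a b where p: "p = (v @ [a], b)" and len: "length v = m"
    and x: "F_word q (v @ [a]) (q b) = x"
    by (auto simp: corners_def length_Suc_conv_rev)
  have "a = b" using junction_new[of a b v] assms x len by auto
  then show "p \<in> (\<lambda>(w, j). (w @ [j], j)) ` corners m x"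
    using p len x by (force simp: corners_def F_word_append)
qed (auto simp: corners_def F_word_append)

lemma sum_corners_Suc:
  assumes "x \<in> V q m"
  shows "(\<Sum>(w, j)\<in>corners (Suc m) x. g w) = (\<Sum>(w, j)\<in>corners m x. g (w @ [j]))"
  unfolding corners_Suc[OF assms]
  by (subst sum.reindex) (auto simp: inj_on_def split_beta)

lemma V_Suc_cases:
  assumes "x \<in> V q (Suc m)"
  obtains "x \<in> V q m" | w i l where "length w = m" "i \<noteq> l" "x = F_word q (w @ [i]) (q l)"
proof -
  obtain v l where "length v = Suc m" "x = F_word q v (q l)" using assms by (rule V_E)
  then obtain w i where w: "length w = m" "x = F_word q (w @ [i]) (q l)"
    by (auto simp: length_Suc_conv_rev)
  show thesis
  proof (cases "i = l")
    case True
    then have "x \<in> V q m" using w by (simp add: F_word_append V_I)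
    then show thesis by (rule that)
  qed (use w that in blast)
qed

text \<open>An interior vertex is born as a midpoint in two cells. Refinement replaces each of these
  by its one subcell at that corner.\<close>

lemma card_corners:
  "x \<in> V q m - V q 0 \<Longrightarrow> card (corners m x) = 2"
proof (induction m)
  case (Suc m)
  from Suc.prems have "x \<in> V q (Suc m)" by simp
  then show ?case
  proof (cases rule: V_Suc_cases)
    case 1
    then have "card (corners (Suc m) x) = card (corners m x)"
      by (subst corners_Suc) (auto intro!: card_image simp: inj_on_def)
    with Suc 1 show ?thesis by simp
  qed (auto simp: corners_junction)
qed simp

section \<open>Comparison of consecutive levels\<close>

lemma cell_sum_around:
  "cell_sum u w x = (u (F_word q w (q j)) - u x) + (u (F_word q w (q (j + 1))) - u x)
    + (u (F_word q w (q (j - 1))) - u x)"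
  unfolding cell_sum_def by (rule sum_around)

lemma graph_sum_junction:
  assumes "i \<noteq> l"
  shows "graph_sum (Suc (length w)) u (F_word q (w @ [i]) (q l)) =
    cell_sum u (w @ [i]) (F_word q (w @ [i]) (q l)) + cell_sum u (w @ [l]) (F_word q (w @ [i]) (q l))"
  using assms junction_interior[OF assms, of w] by (simp add: graph_sum_eq corners_junction)

text \<open>The local picture: \<open>A\<close>, \<open>B\<close>, \<open>C\<close> are the values
  at the corners \<open>j\<close>, \<open>j + 1\<close>, \<open>j - 1\<close> of the cell
  \<open>w\<close>, and \<open>x\<close>, \<open>y\<close>, \<open>z\<close> those at the midpoints
  opposite to \<open>A\<close>, \<open>C\<close>, \<open>B\<close> respectively. The four neighbours
  of each midpoint all lie in this cell.\<close>

lemma graph_sum_junctions: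
  fixes j :: 3
  assumes "A = u (F_word q w (q j))" "B = u (F_word q w (q (j + 1)))" "C = u (F_word q w (q (j - 1)))"
    and "x = u (F_word q (w @ [j + 1]) (q (j - 1)))"
    and "y = u (F_word q (w @ [j]) (q (j + 1)))"
    and "z = u (F_word q (w @ [j]) (q (j - 1)))"
  shows "graph_sum (Suc (length w)) u (F_word q (w @ [j + 1]) (q (j - 1))) = B + C + y + z - 4 * x"
    and "graph_sum (Suc (length w)) u (F_word q (w @ [j]) (q (j + 1))) = A + B + x + z - 4 * y"
    and "graph_sum (Suc (length w)) u (F_word q (w @ [j]) (q (j - 1))) = A + C + x + y - 4 * z"
    and "cell_sum u w (F_word q w (q j)) = B + C - 2 * A"
    and "cell_sum u (w @ [j]) (F_word q w (q j)) = y + z - 2 * A"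
proof -
  have [simp]: "F_word q (w @ [i]) (q i) = F_word q w (q i)" for i
    by (simp add: F_word_append)
  have c: "F_word q (w @ [i]) (q l) = F_word q (w @ [l]) (q i)" for i l
    by (simp add: F_word_append F_vertex_commute[of i])
  show "graph_sum (Suc (length w)) u (F_word q (w @ [j + 1]) (q (j - 1))) = B + C + y + z - 4 * x"
    using assms c[of "j + 1" j] c[of "j - 1" j] c[of "j + 1" "j - 1"]
    by (simp add: graph_sum_junction cell_sum_around[where j = j])
  show "graph_sum (Suc (length w)) u (F_word q (w @ [j]) (q (j + 1))) = A + B + x + z - 4 * y"
    using assms c[of "j + 1" j] c[of "j - 1" j] c[of "j + 1" "j - 1"]
    by (simp add: graph_sum_junction cell_sum_around[where j = j])
  show "graph_sum (Suc (length w)) u (F_word q (w @ [j]) (q (j - 1))) = A + C + x + y - 4 * z"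
    using assms c[of "j + 1" j] c[of "j - 1" j] c[of "j + 1" "j - 1"]
    by (simp add: graph_sum_junction cell_sum_around[where j = j])
  show "cell_sum u w (F_word q w (q j)) = B + C - 2 * A"
    and "cell_sum u (w @ [j]) (F_word q w (q j)) = y + z - 2 * A"
    using assms by (simp_all add: cell_sum_around[where j = j])
qed

text \<open>The expression inside the absolute value is 1/5 times the graph sum at the midpoint
  opposite to the corner \<open>j\<close> plus 2/5 times each of those at the two adjacent
  midpoints. With these weights the value at the opposite midpoint cancels; they add up to 1, whence
  the bound \<open>e\<close>.\<close>

lemma cell_sum_bound:
  assumes "\<And>x. x \<in> V q (Suc (length w)) - V q 0 \<Longrightarrow> \<bar>graph_sum (Suc (length w)) u x\<bar> \<le> e"
  shows "\<bar>3/5 * cell_sum u w (F_word q w (q j)) - cell_sum u (w @ [j]) (F_word q w (q j))\<bar> \<le> e"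
proof -
  have "\<bar>graph_sum (Suc (length w)) u (F_word q (w @ [j + 1]) (q (j - 1)))\<bar> \<le> e"
    "\<bar>graph_sum (Suc (length w)) u (F_word q (w @ [j]) (q (j + 1)))\<bar> \<le> e"
    "\<bar>graph_sum (Suc (length w)) u (F_word q (w @ [j]) (q (j - 1)))\<bar> \<le> e"
    by (intro assms junction_interior; simp)+
  then show ?thesis
    unfolding graph_sum_junctions[OF refl refl refl refl refl refl] abs_le_iff by (simp add: field_simps)
qed

text \<open>Normalised by \<open>5 ^ m\<close>, this says that the supremum of the discrete Laplacian does not grow
  when passing to a coarser level: up to the factor \<open>3/5\<close>, the difference quotient at \<open>x\<close> on level
  \<open>m\<close> is a weighted sum of those on level \<open>m + 1\<close> at \<open>x\<close> and at the new points of its two cells.\<close>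

lemma graph_sum_bound:
  assumes e: "\<And>x. x \<in> V q (Suc m) - V q 0 \<Longrightarrow> \<bar>graph_sum (Suc m) u x\<bar> \<le> e"
    and x: "x \<in> V q m - V q 0"
  shows "\<bar>graph_sum m u x\<bar> \<le> 5 * e"
proof -
  have x': "x \<in> V q m" "x \<in> V q (Suc m)" using x V_mono_Suc[of q m] by blast+
  have "3/5 * graph_sum m u x - graph_sum (Suc m) u x =
    (\<Sum>(w, j)\<in>corners m x. 3/5 * cell_sum u w x - cell_sum u (w @ [j]) x)"
    unfolding graph_sum_eq[OF x'(1)] graph_sum_eq[OF x'(2)] sum_corners_Suc[OF x'(1)]
    by (simp add: split_beta sum_subtractf sum_distrib_left)
  also have "\<bar>\<dots>\<bar> \<le> (\<Sum>p\<in>corners m x. e)"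
  proof (rule order_trans[OF sum_abs], rule sum_mono)
    fix p assume "p \<in> corners m x"
    then obtain w j where "p = (w, j)" "length w = m" "x = F_word q w (q j)"
      by (auto simp: corners_def)
    then show "\<bar>case p of (w, j) \<Rightarrow> 3/5 * cell_sum u w x - cell_sum u (w @ [j]) x\<bar> \<le> e"
      using cell_sum_bound[of w u e j] e by simp
  qed
  also have "\<dots> = 2 * e" using card_corners[OF x] by simp
  finally have "\<bar>3/5 * graph_sum m u x - graph_sum (Suc m) u x\<bar> \<le> 2 * e" .
  moreover have "\<bar>graph_sum (Suc m) u x\<bar> \<le> e" using e x x' by simp
  \<comment> \<open>The two cells and \<open>x\<close> itself contribute \<open>e\<close> each, so
    3/5 of the coarse sum is at most \<open>3 * e\<close>. The resulting factor 5 is exactly the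
    ratio of the normalisations \<open>5 ^ Suc m\<close> and \<open>5 ^ m\<close>.\<close>
  ultimately show ?thesis by linarith
qed

lemma discrete_laplacian_eq: "discrete_laplacian q SG m u x = 3/2 * 5 ^ m * graph_sum m u x"
  by (simp add: discrete_laplacian_def graph_sum_def)

lemma discrete_laplacian_bound:
  assumes "m \<le> n" "\<And>x. x \<in> V q n - V q 0 \<Longrightarrow> \<bar>discrete_laplacian q SG n u x\<bar> \<le> d"
    and "x \<in> V q m - V q 0"
  shows "\<bar>discrete_laplacian q SG m u x\<bar> \<le> d"
  using assms
proof (induction n arbitrary: x rule: dec_induct)
  case (step n)
  have "\<bar>discrete_laplacian q SG n u y\<bar> \<le> d" if y: "y \<in> V q n - V q 0" for y
  proof -
    have "\<bar>graph_sum (Suc n) u z\<bar> \<le> d / (3/2 * 5 ^ Suc n)" if "z \<in> V q (Suc n) - V q 0" for z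
      using step.prems(1)[OF that] by (simp add: discrete_laplacian_eq abs_mult field_simps)
    from graph_sum_bound[OF this y] show ?thesis
      by (simp add: discrete_laplacian_eq abs_mult field_simps)
  qed
  then show ?case using step by blast
qed

section \<open>Rigidity of harmonic functions\<close>

definition harmonic :: "(real^2 \<Rightarrow> real) \<Rightarrow> bool" where
  "harmonic u \<longleftrightarrow> continuous_on SG u \<and> (\<forall>m. \<forall>x\<in>V q m - V q 0. graph_sum m u x = 0)"

lemma has_laplacian_0_harmonic:
  assumes "has_laplacian q SG u f" "\<And>x. x \<in> SG \<Longrightarrow> f x = 0"
  shows "harmonic u"
proof -
  have "discrete_laplacian q SG m u x = 0" if x: "x \<in> V q m - V q 0" for m x
  proof -
    have "\<bar>discrete_laplacian q SG m u x\<bar> \<le> e" if "e > 0" for e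
    proof -
      obtain N where N: "\<And>n y. n \<ge> N \<Longrightarrow> y \<in> V q n - V q 0 \<Longrightarrow> \<bar>discrete_laplacian q SG n u y - f y\<bar> < e"
        using assms(1) \<open>e > 0\<close> unfolding has_laplacian_def by meson
      have "\<bar>discrete_laplacian q SG (max m N) u y\<bar> \<le> e" if y: "y \<in> V q (max m N) - V q 0" for y
      proof -
        have "f y = 0" using y V_SG assms(2) by blast
        then show ?thesis using N[of "max m N" y] y by simp
      qed
      then show ?thesis using discrete_laplacian_bound[of m "max m N" u e x] x by simp
    qed
    then show ?thesis by (metis field_le_epsilon abs_le_zero_iff add_0)
  qed
  then show ?thesis using assms(1)
    by (simp add: harmonic_def has_laplacian_def discrete_laplacian_eq)
qed

text \<open>The 1/5-2/5 extension rule: vanishing of the graph sums at the three midpoints is a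
  linear system for the midpoint values with the corner values as data.\<close>

lemma harmonic_midpoint_around:
  assumes "harmonic u"
  shows "u (F_word q (w @ [j + 1]) (q (j - 1))) =
    (u (F_word q w (q j)) + 2 * u (F_word q w (q (j + 1))) + 2 * u (F_word q w (q (j - 1)))) / 5"
proof -
  have "graph_sum (Suc (length w)) u (F_word q (w @ [j + 1]) (q (j - 1))) = 0"
    "graph_sum (Suc (length w)) u (F_word q (w @ [j]) (q (j + 1))) = 0"
    "graph_sum (Suc (length w)) u (F_word q (w @ [j]) (q (j - 1))) = 0"
    using assms junction_interior unfolding harmonic_def by simp_all
  moreover have "x = (A + 2 * B + 2 * C) / 5"
    if "B + C + y + z - 4 * x = 0" "A + B + x + z - 4 * y = 0" "A + C + x + y - 4 * z = 0"
    for A B C x y z :: real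
    using that by argo
  ultimately show ?thesis
    unfolding graph_sum_junctions[OF refl refl refl refl refl refl] by blast
qed

lemma zero_on_SG:
  assumes "continuous_on SG f" "\<And>w i l. i \<noteq> l \<Longrightarrow> f (F_word q w (F q i (q l))) = 0" "x \<in> SG"
  shows "f x = (0::real)"
proof (rule ccontr)
  assume "f x \<noteq> 0"
  then obtain d where d: "d > 0" "\<And>y. y \<in> SG \<Longrightarrow> dist y x < d \<Longrightarrow> dist (f y) (f x) < \<bar>f x\<bar>"
    using assms(1,3) unfolding continuous_on_iff by (metis zero_less_abs_iff)
  obtain w i l where "i \<noteq> l" "dist (F_word q w (F q i (q l))) x < d"
    using dense_interior[OF assms(3) d(1)] by metis
  then have "dist (f (F_word q w (F q i (q l)))) (f x) < \<bar>f x\<bar>"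
    by (intro d F_word_SG F_SG vertex_SG)
  then show False using assms(2)[OF \<open>i \<noteq> l\<close>] by (simp add: dist_real_def)
qed

lemma harmonic_midpoint:
  assumes "harmonic u" "i \<noteq> l" "i \<noteq> t" "l \<noteq> t"
  shows "u (F_word q w (F q i (q l))) =
    (2 * u (F_word q w (q i)) + 2 * u (F_word q w (q l)) + u (F_word q w (q t))) / 5"
proof -
  have "i = t + 1 \<and> l = t - 1 \<or> i = t - 1 \<and> l = t + 1"
    using assms three_around[of i t] three_around[of l t] by auto
  then show ?thesis
    using harmonic_midpoint_around[OF assms(1), of w t]
    by (elim disjE conjE) (simp_all add: F_word_append F_vertex_commute[of "t - 1"])
qed

lemma harmonic_eq_0:
  assumes "harmonic u" "\<And>i. u (q i) = 0" "x \<in> SG"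
  shows "u x = 0"
proof -
  have vertices: "u (F_word q w (q l)) = 0" for w l
  proof (induction w arbitrary: l rule: rev_induct)
    case (snoc i w)
    show ?case
    proof (cases "i = l")
      case False
      obtain t where "i \<noteq> t" "l \<noteq> t" using third_index[OF False] by metis
      then show ?thesis
        by (simp add: harmonic_midpoint[OF assms(1) False] snoc F_word_append)
    qed (simp add: F_word_append snoc)
  qed (simp add: assms(2))
  show ?thesis
  proof (rule zero_on_SG)
    show "u (F_word q w (F q i (q l))) = 0" for w i l
      using vertices[of "w @ [i]" l] by (simp add: F_word_append)
  qed (use assms in \<open>auto simp: harmonic_def\<close>)
qed

text \<open>When \<open>u (q n) = 0\<close>, the extension rule acts on the two neighbouring values
  with eigenvalue 3/5 on their sum and 1/5 on their difference. The factors 5/3 and 5 in the two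
  derivatives cancel these exactly, so the sequences defining them are constant and the limits
  already give the values at the other two vertices.\<close>

lemma harmonic_jet_eq_0:
  assumes u: "harmonic u" "u (q n) = 0" "has_normal_derivative q u n 0" "has_tangential_derivative q u n 0"
    and "x \<in> SG"
  shows "u x = 0"
proof -
  define a where "a m = u ((F q n ^^ m) (q (n + 1)))" for m
  define b where "b m = u ((F q n ^^ m) (q (n - 1)))" for m
  have "a (Suc m) = (2 * a m + b m) / 5 \<and> b (Suc m) = (a m + 2 * b m) / 5" for m
    using harmonic_midpoint[OF u(1), of n "n + 1" "n - 1" "replicate m n"]
      harmonic_midpoint[OF u(1), of n "n - 1" "n + 1" "replicate m n"] u(2)
    by (simp add: a_def b_def F_word_replicate funpow_swap1)
  then have "a (Suc m) + b (Suc m) = (3/5) * (a m + b m)" "a (Suc m) - b (Suc m) = (1/5) * (a m - b m)" for m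
    by (auto simp: field_simps)
  then have sums: "a m + b m = (3/5) ^ m * (a 0 + b 0)" "a m - b m = (1/5) ^ m * (a 0 - b 0)" for m
    by (induction m) simp_all
  have "(5/3) ^ m * (3/5) ^ m = (1::real)" "5 ^ m * (1/5) ^ m = (1::real)" for m
    by (simp_all flip: power_mult_distrib)
  then have "(5/3) ^ m * (- a m - b m) = - (a 0 + b 0)" "5 ^ m * (a m - b m) = a 0 - b 0" for m
    using arg_cong[OF sums(1)[of m], of "\<lambda>t. - ((5/3) ^ m * t)"] arg_cong[OF sums(2)[of m], of "\<lambda>t. 5 ^ m * t"]
    by (simp_all add: algebra_simps flip: mult.assoc)
  then have "(\<lambda>m. - (a 0 + b 0)) \<longlonglongrightarrow> 0" "(\<lambda>m. a 0 - b 0) \<longlonglongrightarrow> 0"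
    using u unfolding has_normal_derivative_def has_tangential_derivative_def
    by (simp_all flip: a_def b_def)
  then have "a 0 + b 0 = 0" "a 0 - b 0 = 0" by (simp_all add: LIMSEQ_const_iff)
  then have "u (q (n + 1)) = 0" "u (q (n - 1)) = 0" by (simp_all add: a_def b_def)
  then have "u (q i) = 0" for i using three_around[of i n] u(2) by auto
  then show ?thesis using harmonic_eq_0 assms by blast
qed

end

subsection \<open>Reflections and monomials\<close>

context gasket begin

section \<open>Calculus of the Laplacian\<close>

lemma discrete_laplacian_add:
  "discrete_laplacian q SG m (\<lambda>x. u x + v x) x = discrete_laplacian q SG m u x + discrete_laplacian q SG m v x"
  unfolding discrete_laplacian_def by (simp add: algebra_simps sum_subtractf sum.distrib)

lemma discrete_laplacian_cmult:
  "discrete_laplacian q SG m (\<lambda>x. c * u x) x = c * discrete_laplacian q SG m u x"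
  unfolding discrete_laplacian_def by (simp flip: sum_distrib_left right_diff_distrib)

lemma discrete_laplacian_cong:
  assumes "\<And>x. x \<in> SG \<Longrightarrow> u x = v x" "x \<in> SG"
  shows "discrete_laplacian q SG m u x = discrete_laplacian q SG m v x"
proof -
  have "u y - u x = v y - v x" if "adjacent q SG m x y" for y
    using that assms V_SG[of m] by (auto simp: adjacent_def)
  then show ?thesis unfolding discrete_laplacian_def by (auto intro!: sum.cong)
qed

lemma has_laplacian_add:
  assumes "has_laplacian q SG u f" "has_laplacian q SG v g"
  shows "has_laplacian q SG (\<lambda>x. u x + v x) (\<lambda>x. f x + g x)"
  unfolding has_laplacian_def
proof (intro conjI allI impI)
  fix e :: real assume "e > 0"
  then have "e / 2 > 0" by simp
  then obtain N M where
    N: "\<And>m x. m \<ge> N \<Longrightarrow> x \<in> V q m - V q 0 \<Longrightarrow> \<bar>discrete_laplacian q SG m u x - f x\<bar> < e / 2"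
    and M: "\<And>m x. m \<ge> M \<Longrightarrow> x \<in> V q m - V q 0 \<Longrightarrow> \<bar>discrete_laplacian q SG m v x - g x\<bar> < e / 2"
    using assms unfolding has_laplacian_def by meson
  show "\<exists>N. \<forall>m\<ge>N. \<forall>x\<in>V q m - V q 0.
    \<bar>discrete_laplacian q SG m (\<lambda>x. u x + v x) x - (f x + g x)\<bar> < e"
  proof (intro exI[of _ "max N M"] allI impI ballI)
    fix m x assume "max N M \<le> m" "x \<in> V q m - V q 0"
    then show "\<bar>discrete_laplacian q SG m (\<lambda>x. u x + v x) x - (f x + g x)\<bar> < e"
      using N[of m x] M[of m x] unfolding discrete_laplacian_add by linarith
  qed
qed (use assms in \<open>auto simp: has_laplacian_def intro!: continuous_intros\<close>)

lemma has_laplacian_cmult: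
  assumes "has_laplacian q SG u f"
  shows "has_laplacian q SG (\<lambda>x. c * u x) (\<lambda>x. c * f x)"
  unfolding has_laplacian_def
proof (intro conjI allI impI)
  fix e :: real assume "e > 0"
  then have "e / (\<bar>c\<bar> + 1) > 0" by simp
  then obtain N where
    N: "\<And>m x. m \<ge> N \<Longrightarrow> x \<in> V q m - V q 0 \<Longrightarrow> \<bar>discrete_laplacian q SG m u x - f x\<bar> < e / (\<bar>c\<bar> + 1)"
    using assms unfolding has_laplacian_def by meson
  show "\<exists>N. \<forall>m\<ge>N. \<forall>x\<in>V q m - V q 0. \<bar>discrete_laplacian q SG m (\<lambda>x. c * u x) x - c * f x\<bar> < e"
  proof (intro exI[of _ N] allI impI ballI)
    fix m x assume "N \<le> m" "x \<in> V q m - V q 0"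
    then have "\<bar>c\<bar> * \<bar>discrete_laplacian q SG m u x - f x\<bar> \<le> \<bar>c\<bar> * (e / (\<bar>c\<bar> + 1))"
      using N[of m x] by (intro mult_left_mono) auto
    also have "\<dots> < e" using \<open>e > 0\<close> by (simp add: field_simps)
    finally show "\<bar>discrete_laplacian q SG m (\<lambda>x. c * u x) x - c * f x\<bar> < e"
      by (simp add: discrete_laplacian_cmult abs_mult flip: right_diff_distrib)
  qed
qed (use assms in \<open>auto simp: has_laplacian_def intro!: continuous_intros\<close>)

lemma has_laplacian_diff:
  assumes "has_laplacian q SG u f" "has_laplacian q SG v g"
  shows "has_laplacian q SG (\<lambda>x. u x - v x) (\<lambda>x. f x - g x)"
  using has_laplacian_add[OF assms(1) has_laplacian_cmult[OF assms(2), of "-1"]] by simp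

lemma has_laplacian_cong:
  assumes "has_laplacian q SG u f" "\<And>x. x \<in> SG \<Longrightarrow> u x = v x" "\<And>x. x \<in> SG \<Longrightarrow> f x = g x"
  shows "has_laplacian q SG v g"
proof -
  have "discrete_laplacian q SG m v x - g x = discrete_laplacian q SG m u x - f x"
    if "x \<in> V q m - V q 0" for m x
    using discrete_laplacian_cong[of u v x m] assms that V_SG[of m] by auto
  moreover have "continuous_on SG v" "continuous_on SG g"
    using assms continuous_on_cong[of SG SG u v] continuous_on_cong[of SG SG f g]
    by (auto simp: has_laplacian_def)
  ultimately show ?thesis using assms(1) by (simp add: has_laplacian_def)
qed

lemma has_laplacian_const: "has_laplacian q SG (\<lambda>x. c) (\<lambda>x. 0)"
  unfolding has_laplacian_def discrete_laplacian_def by auto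

text \<open>The limits fix the Laplacian only at interior vertices; continuity and density extend
  the equality to the whole gasket, boundary included.\<close>

lemma has_laplacian_unique:
  assumes "has_laplacian q SG u f" "has_laplacian q SG v g" "\<And>x. x \<in> SG \<Longrightarrow> u x = v x" "x \<in> SG"
  shows "f x = g x"
proof -
  have lap: "has_laplacian q SG (\<lambda>x. 0) (\<lambda>x. f x - g x)"
    using has_laplacian_cong[OF has_laplacian_diff[OF assms(1,2)]] assms(3) by simp
  have "f x - g x = 0"
  proof (rule zero_on_SG[of "\<lambda>x. f x - g x"])
    fix w i l assume "(i::3) \<noteq> l"
    define p where "p = F_word q w (F q i (q l))"
    have p: "p \<in> V q (Suc (length w)) - V q 0"
      using junction_interior[OF \<open>i \<noteq> l\<close>, of w] by (simp add: p_def F_word_append)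
    have "\<bar>f p - g p\<bar> \<le> e" if e: "e > 0" for e
    proof -
      obtain N where N: "\<And>n y. n \<ge> N \<Longrightarrow> y \<in> V q n - V q 0 \<Longrightarrow>
        \<bar>discrete_laplacian q SG n (\<lambda>x. 0) y - (f y - g y)\<bar> < e"
        using lap e unfolding has_laplacian_def by meson
      have "p \<in> V q (max N (Suc (length w))) - V q 0"
        using p V_mono[of "Suc (length w)" "max N (Suc (length w))" q] by auto
      then show ?thesis using N[of "max N (Suc (length w))" p]
        by (simp add: discrete_laplacian_def abs_minus_commute)
    qed
    then show "f p - g p = 0" by (metis field_le_epsilon abs_le_zero_iff add_0)
  qed (use lap assms(4) in \<open>auto simp: has_laplacian_def\<close>)
  then show ?thesis by simp
qed

text \<open>Modulo 3, the index map sending \<open>i\<close> to \<open>c - i\<close> is a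
  transposition, so \<open>c\<close> runs through all three reflections; \<open>c = i + i\<close>
  gives the one fixing \<open>q i\<close>. In barycentric coordinates the map is affine, hence
  continuous, and it intertwines \<open>F q j\<close> with \<open>F q (c - j)\<close>.\<close>

definition reflect :: "3 \<Rightarrow> real^2 \<Rightarrow> real^2" where
  "reflect c x = (\<Sum>i\<in>UNIV. bary i x *\<^sub>R q (c - i))"

lemma reflect_vertex: "reflect c (q j) = q (c - j)"
  unfolding reflect_def by (simp add: bary_vertex if_distrib[of "\<lambda>t. t *\<^sub>R _"] cong: if_cong)

lemma reflect_F: "reflect c (F q j x) = F q (c - j) (reflect c x)"
proof -
  have "bary i (F q j x) *\<^sub>R q (c - i) =
    (1/2) *\<^sub>R (bary i x *\<^sub>R q (c - i)) + (if i = j then (1/2) *\<^sub>R q (c - i) else 0)" for i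
    by (simp add: bary_F scaleR_add_left add_divide_distrib)
  then show ?thesis
    unfolding reflect_def F_eq by (simp add: sum.distrib scaleR_sum_right algebra_simps)
qed

lemma reflect_F_word: "reflect c (F_word q w x) = F_word q (map (\<lambda>i. c - i) w) (reflect c x)"
  by (induction w) (auto simp: reflect_F)

lemma reflect_funpow: "reflect c ((F q i ^^ m) x) = (F q (c - i) ^^ m) (reflect c x)"
  using reflect_F_word[of c "replicate m i" x] by (simp add: F_word_replicate)

lemma continuous_reflect: "continuous_on S (reflect c)"
  unfolding reflect_def by (intro continuous_intros continuous_bary)

text \<open>Vertices are mapped to vertices by an explicit formula; they are dense in the gasket,
  which is closed.\<close>

lemma reflect_SG: "x \<in> SG \<Longrightarrow> reflect c x \<in> SG"
proof -
  let ?V = "\<Union>m. V q m"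
  have "SG \<subseteq> closure ?V"
  proof
    fix x assume x: "x \<in> SG"
    show "x \<in> closure ?V" unfolding closure_approachable
    proof (intro allI impI)
      fix e :: real assume "e > 0"
      then obtain w i l where *: "(i::3) \<noteq> l" "dist (F_word q w (F q i (q l))) x < e"
        using dense_interior[OF x] by metis
      then have "F_word q w (F q i (q l)) \<in> V q (Suc (length w))"
        using V_I[of "w @ [i]" "Suc (length w)" q l] by (simp only: F_word_append length_append_singleton) simp
      with * show "\<exists>y\<in>?V. dist y x < e" by blast
    qed
  qed
  moreover have "reflect c ` closure ?V \<subseteq> SG"
  proof (rule image_closure_subset)
    show "reflect c ` ?V \<subseteq> SG"
      by (auto elim!: V_E simp: reflect_F_word reflect_vertex intro!: F_word_SG vertex_SG)
  qed (use continuous_reflect compact_imp_closed[OF compact_SG] in auto)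
  ultimately show "x \<in> SG \<Longrightarrow> reflect c x \<in> SG" by blast
qed

lemma reflect_reflect:
  assumes "x \<in> SG"
  shows "reflect c (reflect c x) = x"
proof -
  have "norm (reflect c (reflect c x) - x) = 0"
  proof (rule zero_on_SG[of "\<lambda>x. norm (reflect c (reflect c x) - x)"])
    show "continuous_on SG (\<lambda>x. norm (reflect c (reflect c x) - x))"
      by (intro continuous_intros continuous_on_compose2[OF continuous_reflect continuous_reflect subset_UNIV])
  qed (simp_all add: reflect_F_word reflect_F reflect_vertex assms comp_def)
  then show ?thesis by simp
qed

lemma reflect_V: "x \<in> V q m \<Longrightarrow> reflect c x \<in> V q m"
  by (erule V_E) (simp add: reflect_F_word reflect_vertex V_I)

lemma reflect_interior: "x \<in> V q m - V q 0 \<Longrightarrow> reflect c x \<in> V q m - V q 0"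
  using reflect_V[of x m c] reflect_V[of "reflect c x" 0 c] reflect_reflect[of x c] V_SG[of m] by auto

lemma adjacent_reflect:
  assumes "adjacent q SG m x y"
  shows "adjacent q SG m (reflect c x) (reflect c y)"
proof -
  obtain w where w: "x \<in> V q m" "y \<in> V q m" "x \<noteq> y" "length w = m" "x \<in> cell q SG w" "y \<in> cell q SG w"
    using assms by (auto simp: adjacent_def)
  then have "reflect c x \<noteq> reflect c y"
    using reflect_reflect[of x c] reflect_reflect[of y c] V_SG[of m] by (metis subsetD)
  moreover have "reflect c z \<in> cell q SG (map (\<lambda>i. c - i) w)" if "z \<in> cell q SG w" for z
    using that by (auto simp: cell_def reflect_F_word intro!: imageI reflect_SG)
  ultimately show ?thesis
    unfolding adjacent_def using w by (metis length_map reflect_V)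
qed

lemma discrete_laplacian_reflect:
  assumes "x \<in> SG"
  shows "discrete_laplacian q SG m (\<lambda>x. u (reflect c x)) x = discrete_laplacian q SG m u (reflect c x)"
proof -
  have inv: "reflect c (reflect c y) = y" if "adjacent q SG m z y" for z y
    using that V_SG[of m] by (intro reflect_reflect) (auto simp: adjacent_def)
  have "(\<Sum>y | adjacent q SG m x y. u (reflect c y) - u (reflect c x))
    = (\<Sum>y | adjacent q SG m (reflect c x) y. u y - u (reflect c x))"
  proof (rule sum.reindex_bij_witness[of _ "reflect c" "reflect c"])
    fix y assume "y \<in> {y. adjacent q SG m (reflect c x) y}"
    then show "reflect c y \<in> {y. adjacent q SG m x y}"
      using adjacent_reflect[of m "reflect c x" y c] reflect_reflect[OF assms, of c] by simp
  qed (auto simp: inv intro: adjacent_reflect)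
  then show ?thesis by (simp add: discrete_laplacian_def)
qed

lemma has_laplacian_reflect:
  assumes "has_laplacian q SG u f"
  shows "has_laplacian q SG (\<lambda>x. u (reflect c x)) (\<lambda>x. f (reflect c x))"
  unfolding has_laplacian_def
proof (intro conjI allI impI)
  show "continuous_on SG (\<lambda>x. u (reflect c x))" "continuous_on SG (\<lambda>x. f (reflect c x))"
    using assms reflect_SG unfolding has_laplacian_def
    by (auto intro!: continuous_on_compose2[OF _ continuous_reflect])
  fix e :: real assume "e > 0"
  then obtain N where
    N: "\<And>m x. m \<ge> N \<Longrightarrow> x \<in> V q m - V q 0 \<Longrightarrow> \<bar>discrete_laplacian q SG m u x - f x\<bar> < e"
    using assms unfolding has_laplacian_def by meson
  show "\<exists>N. \<forall>m\<ge>N. \<forall>x\<in>V q m - V q 0.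
    \<bar>discrete_laplacian q SG m (\<lambda>x. u (reflect c x)) x - f (reflect c x)\<bar> < e"
  proof (intro exI[of _ N] allI impI ballI)
    fix m x assume m: "N \<le> m" and x: "x \<in> V q m - V q 0"
    then have "x \<in> SG" using V_SG by blast
    from N[OF m reflect_interior[OF x, of c]]
    show "\<bar>discrete_laplacian q SG m (\<lambda>x. u (reflect c x)) x - f (reflect c x)\<bar> < e"
      unfolding discrete_laplacian_reflect[OF \<open>x \<in> SG\<close>] .
  qed
qed

lemma has_normal_derivative_reflect:
  assumes "has_normal_derivative q u i d"
  shows "has_normal_derivative q (\<lambda>x. u (reflect c x)) (c - i) d"
proof -
  have "c - (c - i + 1) = i - 1" "c - (c - i - 1) = i + 1" "c - (c - i) = i" by simp_all
  then show ?thesis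
    using assms unfolding has_normal_derivative_def reflect_funpow reflect_vertex
    by (simp add: algebra_simps)
qed

text \<open>A reflection reverses the cyclic order and so exchanges the two neighbours of the base
  index. The normal derivative is symmetric in them, the tangential one antisymmetric.\<close>

lemma has_tangential_derivative_reflect:
  assumes "has_tangential_derivative q u i d"
  shows "has_tangential_derivative q (\<lambda>x. u (reflect c x)) (c - i) (- d)"
proof -
  have "c - (c - i + 1) = i - 1" "c - (c - i - 1) = i + 1" "c - (c - i) = i" by simp_all
  then show ?thesis
    using tendsto_minus[OF assms[unfolded has_tangential_derivative_def]]
    unfolding has_tangential_derivative_def reflect_funpow reflect_vertex
    by (simp add: algebra_simps)
qed

lemma has_normal_derivative_cmult:
  "has_normal_derivative q u i d \<Longrightarrow> has_normal_derivative q (\<lambda>x. c * u x) i (c * d)"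
  unfolding has_normal_derivative_def by (drule tendsto_mult_left[of _ _ _ c]) (simp add: algebra_simps)

lemma has_tangential_derivative_cmult:
  "has_tangential_derivative q u i d \<Longrightarrow> has_tangential_derivative q (\<lambda>x. c * u x) i (c * d)"
  unfolding has_tangential_derivative_def by (drule tendsto_mult_left[of _ _ _ c]) (simp add: algebra_simps)

lemma has_normal_derivative_diff:
  "has_normal_derivative q u i d \<Longrightarrow> has_normal_derivative q v i d' \<Longrightarrow>
    has_normal_derivative q (\<lambda>x. u x - v x) i (d - d')"
  unfolding has_normal_derivative_def by (drule (1) tendsto_diff) (simp add: algebra_simps)

lemma has_tangential_derivative_diff:
  "has_tangential_derivative q u i d \<Longrightarrow> has_tangential_derivative q v i d' \<Longrightarrow>
    has_tangential_derivative q (\<lambda>x. u x - v x) i (d - d')"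
  unfolding has_tangential_derivative_def by (drule (1) tendsto_diff) (simp add: algebra_simps)

section \<open>Uniqueness and symmetry of monomials\<close>

lemma is_monomial_0:
  assumes "is_monomial q SG n 0 i P"
  obtains f where "has_laplacian q SG P f" "\<forall>x\<in>SG. f x = 0"
    "P (q n) = (if i = 1 then 1 else 0)"
    "has_normal_derivative q P n (if i = 2 then 1 else 0)"
    "has_tangential_derivative q P n (if i = 3 then 1 else 0)"
proof -
  obtain D where "D 0 = P" "\<forall>m\<le>0. has_laplacian q SG (D m) (D (Suc m))" "\<forall>x\<in>SG. D (Suc 0) x = 0"
    "\<forall>m\<le>0. D m (q n) = (if m = 0 \<and> i = 1 then 1 else 0) \<and>
      has_normal_derivative q (D m) n (if m = 0 \<and> i = 2 then 1 else 0) \<and>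
      has_tangential_derivative q (D m) n (if m = 0 \<and> i = 3 then 1 else 0)"
    using assms unfolding is_monomial_def by blast
  note D = this(1) this(2-4)[rule_format]
  show thesis by (rule that[of "D 1"]) (use D D(4)[of 0] in simp_all)
qed

text \<open>Shifting the sequence \<open>D\<close> by one passes from a monomial to its Laplacian.
  This is the recursion behind the inductions on \<open>j\<close> below.\<close>

lemma is_monomial_Suc:
  assumes "is_monomial q SG n (Suc j) i P"
  obtains P' where "has_laplacian q SG P P'" "is_monomial q SG n j i P'"
    "P (q n) = 0" "has_normal_derivative q P n 0" "has_tangential_derivative q P n 0"
proof -
  obtain D where "D 0 = P" "\<forall>m\<le>Suc j. has_laplacian q SG (D m) (D (Suc m))" "\<forall>x\<in>SG. D (Suc (Suc j)) x = 0"
    "\<forall>m\<le>Suc j. D m (q n) = (if m = Suc j \<and> i = 1 then 1 else 0) \<and>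
      has_normal_derivative q (D m) n (if m = Suc j \<and> i = 2 then 1 else 0) \<and>
      has_tangential_derivative q (D m) n (if m = Suc j \<and> i = 3 then 1 else 0)"
    using assms unfolding is_monomial_def by blast
  note D = this(1) this(2-4)[rule_format]
  have "is_monomial q SG n j i (D 1)"
    unfolding is_monomial_def
  proof (intro exI[of _ "\<lambda>m. D (Suc m)"] conjI allI impI ballI)
    fix m assume "m \<le> j"
    then show "has_laplacian q SG (D (Suc m)) (D (Suc (Suc m)))"
      "D (Suc m) (q n) = (if m = j \<and> i = 1 then 1 else 0)"
      "has_normal_derivative q (D (Suc m)) n (if m = j \<and> i = 2 then 1 else 0)"
      "has_tangential_derivative q (D (Suc m)) n (if m = j \<and> i = 3 then 1 else 0)"
      using D(2)[of "Suc m"] D(4)[of "Suc m"] by simp_all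
  qed (use D(3) in auto)
  then show thesis
    using that[of "D 1"] D(1) D(2)[of 0] D(4)[of 0] by simp
qed

text \<open>By induction the Laplacians agree, so the difference is harmonic, and its value and both
  derivatives at \<open>q n\<close> vanish because the prescribed data coincide.\<close>

lemma is_monomial_unique:
  assumes "is_monomial q SG n j i P" "is_monomial q SG n j i P'" "x \<in> SG"
  shows "P x = P' x"
  using assms
proof (induction j arbitrary: P P' x)
  case 0
  obtain f where f: "has_laplacian q SG P f" "\<forall>x\<in>SG. f x = 0"
    "P (q n) = (if i = 1 then 1 else 0)"
    "has_normal_derivative q P n (if i = 2 then 1 else 0)"
    "has_tangential_derivative q P n (if i = 3 then 1 else 0)"
    using 0(1) by (rule is_monomial_0)
  obtain f' where f': "has_laplacian q SG P' f'" "\<forall>x\<in>SG. f' x = 0"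
    "P' (q n) = (if i = 1 then 1 else 0)"
    "has_normal_derivative q P' n (if i = 2 then 1 else 0)"
    "has_tangential_derivative q P' n (if i = 3 then 1 else 0)"
    using 0(2) by (rule is_monomial_0)
  have "harmonic (\<lambda>x. P x - P' x)"
    by (rule has_laplacian_0_harmonic[OF has_laplacian_diff[OF f(1) f'(1)]]) (simp add: f(2) f'(2))
  then have "P x - P' x = 0"
    by (rule harmonic_jet_eq_0)
      (use f f' 0 has_normal_derivative_diff[OF f(4) f'(4)] has_tangential_derivative_diff[OF f(5) f'(5)] in simp_all)
  then show ?case by simp
next
  case (Suc j)
  obtain f where f: "has_laplacian q SG P f" "is_monomial q SG n j i f"
    "P (q n) = 0" "has_normal_derivative q P n 0" "has_tangential_derivative q P n 0"
    using Suc(2) by (rule is_monomial_Suc)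
  obtain f' where f': "has_laplacian q SG P' f'" "is_monomial q SG n j i f'"
    "P' (q n) = 0" "has_normal_derivative q P' n 0" "has_tangential_derivative q P' n 0"
    using Suc(3) by (rule is_monomial_Suc)
  have "harmonic (\<lambda>x. P x - P' x)"
    by (rule has_laplacian_0_harmonic[OF has_laplacian_diff[OF f(1) f'(1)]]) (simp add: Suc.IH[OF f(2) f'(2)])
  then have "P x - P' x = 0"
    by (rule harmonic_jet_eq_0)
      (use f f' Suc has_normal_derivative_diff[OF f(4) f'(4)] has_tangential_derivative_diff[OF f(5) f'(5)] in simp_all)
  then show ?case by simp
qed

text \<open>Of the three kinds of data at the base point only the tangential derivative is odd under
  a reflection, hence the sign for type 3 alone. It multiplies the whole sequence of iterated
  Laplacians.\<close>

lemma is_monomial_reflect: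
  assumes "is_monomial q SG n j i P"
  shows "is_monomial q SG (c - n) j i (\<lambda>x. (if i = 3 then - 1 else 1) * P (reflect c x))"
proof -
  define s :: real where "s = (if i = 3 then - 1 else 1)"
  obtain D where "D 0 = P" "\<forall>m\<le>j. has_laplacian q SG (D m) (D (Suc m))" "\<forall>x\<in>SG. D (Suc j) x = 0"
    "\<forall>m\<le>j. D m (q n) = (if m = j \<and> i = 1 then 1 else 0) \<and>
      has_normal_derivative q (D m) n (if m = j \<and> i = 2 then 1 else 0) \<and>
      has_tangential_derivative q (D m) n (if m = j \<and> i = 3 then 1 else 0)"
    using assms unfolding is_monomial_def by blast
  note D = this(1) this(2-3)[rule_format] this(4)[rule_format, THEN conjunct1]
    this(4)[rule_format, THEN conjunct2, THEN conjunct1] this(4)[rule_format, THEN conjunct2, THEN conjunct2]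
  have "is_monomial q SG (c - n) j i (\<lambda>x. s * P (reflect c x))"
    unfolding is_monomial_def
  proof (intro exI[of _ "\<lambda>m x. s * D m (reflect c x)"] conjI allI impI ballI)
    fix m assume m: "m \<le> j"
    show "has_laplacian q SG (\<lambda>x. s * D m (reflect c x)) (\<lambda>x. s * D (Suc m) (reflect c x))"
      by (intro has_laplacian_cmult has_laplacian_reflect D m)
    show "s * D m (reflect c (q (c - n))) = (if m = j \<and> i = 1 then 1 else 0)"
      using D(4)[OF m] by (auto simp: reflect_vertex s_def)
    show "has_normal_derivative q (\<lambda>x. s * D m (reflect c x)) (c - n) (if m = j \<and> i = 2 then 1 else 0)"
      using has_normal_derivative_cmult[OF has_normal_derivative_reflect[OF D(5)[OF m]], of s c]
      by (auto simp: s_def split: if_splits)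
    show "has_tangential_derivative q (\<lambda>x. s * D m (reflect c x)) (c - n) (if m = j \<and> i = 3 then 1 else 0)"
      using has_tangential_derivative_cmult[OF has_tangential_derivative_reflect[OF D(6)[OF m]], of s c]
      by (auto simp: s_def split: if_splits)
  qed (use D(1,3) reflect_SG in auto)
  then show ?thesis by (simp only: s_def)
qed

lemma monomial_3_reflect:
  assumes "is_monomial q SG n j 3 P" "is_monomial q SG (c - n) j 3 P'" "x \<in> SG"
  shows "P (reflect c x) = - P' x"
  using is_monomial_unique[OF is_monomial_reflect[OF assms(1), of c] assms(2,3)] by simp

lemma monomial_1_reflect:
  assumes "is_monomial q SG n j 1 P" "is_monomial q SG (c - n) j 1 P'" "x \<in> SG"
  shows "P (reflect c x) = P' x"
  using is_monomial_unique[OF is_monomial_reflect[OF assms(1), of c] assms(2,3)] by simp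

lemma sum_reflect_index: "(\<Sum>n\<in>UNIV. f (c - n)) = (\<Sum>n\<in>UNIV. f (n :: 3))"
  by (rule sum.reindex_bij_witness[of _ "\<lambda>n. c - n" "\<lambda>n. c - n"]) auto

lemma has_laplacian_sum_three:
  assumes "\<And>n::3. has_laplacian q SG (u n) (f n)"
  shows "has_laplacian q SG (\<lambda>x. \<Sum>n\<in>UNIV. u n x) (\<lambda>x. \<Sum>n\<in>UNIV. f n x)"
  unfolding sum_three by (intro has_laplacian_add assms)

lemma sum_monomial_3_vertex:
  assumes "\<And>n. is_monomial q SG n j 3 (P n)"
  shows "(\<Sum>n\<in>UNIV. P n (q l)) = 0"
proof -
  \<comment> \<open>The reflection with \<open>c = l + l\<close> fixes \<open>q l\<close> and pairs
    the base points \<open>n\<close> and \<open>l + l - n\<close>.\<close>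
  have "P n (q l) = - P (l + l - n) (q l)" for n
    using monomial_3_reflect[OF assms[of n] assms[of "l + l - n"] vertex_SG[of l]]
    by (simp add: reflect_vertex)
  then have "(\<Sum>n\<in>UNIV. P n (q l)) = (\<Sum>n\<in>UNIV. - P (l + l - n) (q l))"
    by (intro sum.cong refl)
  then show ?thesis unfolding sum_negf using sum_reflect_index[of "\<lambda>n. P n (q l)" "l + l"] by simp
qed

lemma sum_monomial_3:
  assumes "\<And>n. is_monomial q SG n j 3 (P n)" "x \<in> SG"
  shows "(\<Sum>n\<in>UNIV. P n x) = 0"
  using assms
proof (induction j arbitrary: P x)
  case (0 P)
  have "\<exists>f. has_laplacian q SG (P n) f \<and> (\<forall>x\<in>SG. f x = 0)" for n
    using is_monomial_0[OF 0(1)[of n]] by metis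
  then obtain f where f: "\<And>n. has_laplacian q SG (P n) (f n)" "\<And>n x. x \<in> SG \<Longrightarrow> f n x = 0"
    by metis
  have "harmonic (\<lambda>x. \<Sum>n\<in>UNIV. P n x)"
    by (rule has_laplacian_0_harmonic[OF has_laplacian_sum_three[OF f(1)]]) (simp add: f)
  then show ?case by (rule harmonic_eq_0) (use sum_monomial_3_vertex 0 in auto)
next
  case (Suc j P)
  have "\<exists>f. has_laplacian q SG (P n) f \<and> is_monomial q SG n j 3 f" for n
    using is_monomial_Suc[OF Suc.prems(1)[of n]] by metis
  then obtain f where f: "\<And>n. has_laplacian q SG (P n) (f n)" "\<And>n. is_monomial q SG n j 3 (f n)"
    by metis
  have "harmonic (\<lambda>x. \<Sum>n\<in>UNIV. P n x)"
    by (rule has_laplacian_0_harmonic[OF has_laplacian_sum_three[OF f(1)]]) (simp add: Suc.IH f)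
  then show ?case by (rule harmonic_eq_0) (use sum_monomial_3_vertex Suc in auto)
qed

text \<open>A function of exact degree \<open>j\<close> does not vanish, and stays of exact degree \<open>j\<close> after adding
  functions of lower degree; hence Gram--Schmidt never divides by zero.\<close>

primrec exact_degree :: "nat \<Rightarrow> (real^2 \<Rightarrow> real) \<Rightarrow> bool" where
  "exact_degree 0 = (\<lambda>f. \<exists>g. has_laplacian q SG f g \<and> (\<forall>x\<in>SG. g x = 0) \<and> (\<exists>x\<in>SG. f x \<noteq> 0))"
| "exact_degree (Suc j) = (\<lambda>f. \<exists>g. has_laplacian q SG f g \<and> exact_degree j g)"

lemma exact_degree_cong:
  assumes "exact_degree j f" "\<And>x. x \<in> SG \<Longrightarrow> f x = g x"
  shows "exact_degree j g"
  using assms has_laplacian_cong[of f _ g] by (cases j) (simp_all, metis+)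

text \<open>If \<open>f\<close> vanished on the gasket, uniqueness of the Laplacian would make
  \<open>g\<close> vanish too, against the induction hypothesis.\<close>

lemma exact_degree_nonzero: "exact_degree j f \<Longrightarrow> \<exists>x\<in>SG. f x \<noteq> 0"
proof (induction j arbitrary: f)
  case (Suc j)
  then obtain g where g: "has_laplacian q SG f g" "exact_degree j g" by auto
  with Suc.IH obtain x where "x \<in> SG" "g x \<noteq> 0" by blast
  then show ?case using has_laplacian_unique[OF g(1) has_laplacian_const[of 0]] by blast
qed auto

lemma exact_degree_add:
  "exact_degree j f \<Longrightarrow> exact_degree k g \<Longrightarrow> k < j \<Longrightarrow> exact_degree j (\<lambda>x. f x + c * g x)"
proof (induction j arbitrary: f g k)
  case (Suc j)
  obtain f' where f': "has_laplacian q SG f f'" "exact_degree j f'" using Suc by auto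
  show ?case
  proof (cases k)
    \<comment> \<open>The added function is harmonic here: one Laplacian removes it, and
      \<open>f'\<close> alone carries the degree.\<close>
    case 0
    then obtain g' where g': "has_laplacian q SG g g'" "\<And>x. x \<in> SG \<Longrightarrow> g' x = 0" using Suc by auto
    have "exact_degree j (\<lambda>x. f' x + c * g' x)"
      by (rule exact_degree_cong[OF f'(2)]) (simp add: g')
    then show ?thesis using has_laplacian_add[OF f'(1) has_laplacian_cmult[OF g'(1), of c]] by auto
  next
    case (Suc k')
    then obtain g' where g': "has_laplacian q SG g g'" "exact_degree k' g'" using Suc.prems by auto
    have "exact_degree j (\<lambda>x. f' x + c * g' x)"
      using Suc.IH[OF f'(2) g'(2)] Suc.prems Suc by simp
    then show ?thesis using has_laplacian_add[OF f'(1) has_laplacian_cmult[OF g'(1), of c]] by auto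
  qed
qed simp

lemma exact_degree_sum:
  assumes "exact_degree j f" "finite T" "\<And>k. k \<in> T \<Longrightarrow> k < j" "\<And>k. k \<in> T \<Longrightarrow> exact_degree k (g k)"
  shows "exact_degree j (\<lambda>x. f x + (\<Sum>k\<in>T. c k * g k x))"
  using assms(2,3,4)
proof (induction T)
  case (insert k T)
  then have "exact_degree j (\<lambda>x. f x + (\<Sum>k\<in>T. c k * g k x) + c k * g k x)"
    by (intro exact_degree_add[where k = k]) auto
  then show ?case using insert by (simp add: ac_simps)
qed (simp add: assms(1))

text \<open>Taking \<open>j\<close> Laplacians leaves a harmonic monomial whose tangential
  derivative is 1, which the zero function does not have.\<close>

lemma exact_degree_monomial_3: "is_monomial q SG n j 3 P \<Longrightarrow> exact_degree j P"
proof (induction j arbitrary: P)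
  case 0
  then obtain f where f: "has_laplacian q SG P f" "\<forall>x\<in>SG. f x = 0"
    and t: "has_tangential_derivative q P n 1" by (auto elim: is_monomial_0)
  have "\<exists>x\<in>SG. P x \<noteq> 0"
  proof (rule ccontr)
    assume "\<not> (\<exists>x\<in>SG. P x \<noteq> 0)"
    moreover have "(F q n ^^ m) (q i) \<in> SG" for m i
      using F_word_SG[OF vertex_SG, of "replicate m n" i] by (simp add: F_word_replicate)
    ultimately have "(\<lambda>m. 0) \<longlonglongrightarrow> (1::real)"
      using t unfolding has_tangential_derivative_def by simp
    then show False by (simp add: LIMSEQ_const_iff)
  qed
  with f show ?case by auto
next
  case (Suc j)
  from Suc.prems show ?case by (rule is_monomial_Suc) (use Suc.IH in auto)
qed

lemma is_monomial_0_1: "is_monomial q SG n 0 1 (\<lambda>x. 1)"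
  unfolding is_monomial_def
  by (rule exI[of _ "\<lambda>m x. if m = 0 then 1 else 0"])
    (auto simp: has_laplacian_const has_normal_derivative_def has_tangential_derivative_def)

text \<open>Taking \<open>j\<close> Laplacians leaves a sum of three constants 1. The evaluation
  matters, since three monomials of exact degree may well cancel, as those of type 3 do.\<close>

lemma exact_degree_sum_monomial_1:
  assumes "\<And>n. is_monomial q SG n j 1 (P n)"
  shows "exact_degree j (\<lambda>x. \<Sum>n\<in>UNIV. P n x)"
  using assms
proof (induction j arbitrary: P)
  case (0 P)
  have "\<exists>f. has_laplacian q SG (P n) f \<and> (\<forall>x\<in>SG. f x = 0)" for n
    using is_monomial_0[OF 0(1)[of n]] by metis
  then obtain f where f: "\<And>n. has_laplacian q SG (P n) (f n)" "\<And>n x. x \<in> SG \<Longrightarrow> f n x = 0"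
    by metis
  have "(\<Sum>n\<in>UNIV. P n (q 0)) \<noteq> 0"
    using is_monomial_unique[OF 0 is_monomial_0_1 vertex_SG] by simp
  then show ?case
    using has_laplacian_sum_three[of P f] f vertex_SG[of 0] by (auto intro!: exI[of _ "\<lambda>x. \<Sum>n\<in>UNIV. f n x"])
next
  case (Suc j P)
  have "\<exists>f. has_laplacian q SG (P n) f \<and> is_monomial q SG n j 1 f" for n
    using is_monomial_Suc[OF Suc.prems[of n]] by metis
  then obtain f where f: "\<And>n. has_laplacian q SG (P n) (f n)" "\<And>n. is_monomial q SG n j 1 (f n)"
    by metis
  then show ?case
    using has_laplacian_sum_three[of P f] Suc.IH[of f] by auto
qed

end

subsection \<open>Orthonormal systems in $L^2$\<close>

lemma l2_functionsI: "f \<in> borel_measurable M \<Longrightarrow> integrable M (\<lambda>x. (f x)\<^sup>2) \<Longrightarrow> f \<in> l2_functions M"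
  by (simp add: l2_functions_def)

lemma l2_mult_integrable:
  assumes "f \<in> l2_functions M" "g \<in> l2_functions M"
  shows "integrable M (\<lambda>x. f x * g x)"
proof (rule Bochner_Integration.integrable_bound[of M "\<lambda>x. (f x)\<^sup>2 + (g x)\<^sup>2"])
  have "norm (f x * g x) \<le> norm ((f x)\<^sup>2 + (g x)\<^sup>2)" for x
  proof -
    have "2 * (\<bar>f x\<bar> * \<bar>g x\<bar>) \<le> (f x)\<^sup>2 + (g x)\<^sup>2"
      using sum_squares_bound[of "\<bar>f x\<bar>" "\<bar>g x\<bar>"] by (simp add: mult.assoc)
    then have "\<bar>f x\<bar> * \<bar>g x\<bar> \<le> (f x)\<^sup>2 + (g x)\<^sup>2"
      using mult_nonneg_nonneg[of "\<bar>f x\<bar>" "\<bar>g x\<bar>"] by linarith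
    then show ?thesis by (simp add: abs_mult)
  qed
  then show "AE x in M. norm (f x * g x) \<le> norm ((f x)\<^sup>2 + (g x)\<^sup>2)" by simp
qed (use assms in \<open>auto simp: l2_functions_def\<close>)

lemma l2_functions_add:
  assumes "f \<in> l2_functions M" "g \<in> l2_functions M"
  shows "(\<lambda>x. f x + g x) \<in> l2_functions M"
proof (rule l2_functionsI)
  show "integrable M (\<lambda>x. (f x + g x)\<^sup>2)"
    using assms l2_mult_integrable[OF assms]
    by (auto simp: power2_sum l2_functions_def mult.assoc)
qed (use assms in \<open>auto simp: l2_functions_def\<close>)

lemma l2_functions_cmult: "f \<in> l2_functions M \<Longrightarrow> (\<lambda>x. c * f x) \<in> l2_functions M"
  by (auto simp: l2_functions_def power_mult_distrib)

lemma l2_functions_diff: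
  "f \<in> l2_functions M \<Longrightarrow> g \<in> l2_functions M \<Longrightarrow> (\<lambda>x. f x - g x) \<in> l2_functions M"
  using l2_functions_add[of f M "\<lambda>x. -1 * g x"] l2_functions_cmult[of g M "-1"] by simp

lemma l2_functions_zero: "(\<lambda>x. 0) \<in> l2_functions M"
  by (simp add: l2_functions_def)

lemma l2_functions_sum:
  "(\<And>k. k \<in> T \<Longrightarrow> g k \<in> l2_functions M) \<Longrightarrow> (\<lambda>x. \<Sum>k\<in>T. c k * g k x) \<in> l2_functions M"
  by (induction T rule: infinite_finite_induct)
    (auto simp: l2_functions_zero intro!: l2_functions_add l2_functions_cmult)

lemma l2_inner_commute: "l2_inner M f g = l2_inner M g f"
  by (simp add: l2_inner_def mult.commute)

lemma l2_inner_add_left: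
  assumes "f \<in> l2_functions M" "g \<in> l2_functions M" "h \<in> l2_functions M"
  shows "l2_inner M (\<lambda>x. f x + g x) h = l2_inner M f h + l2_inner M g h"
  using assms by (simp add: l2_inner_def distrib_right l2_mult_integrable)

lemma l2_inner_cmult_left: "l2_inner M (\<lambda>x. c * f x) g = c * l2_inner M f g"
  by (simp add: l2_inner_def mult.assoc)

lemma l2_inner_sum_left:
  assumes "\<And>k. k \<in> T \<Longrightarrow> g k \<in> l2_functions M" "h \<in> l2_functions M"
  shows "l2_inner M (\<lambda>x. \<Sum>k\<in>T. c k * g k x) h = (\<Sum>k\<in>T. c k * l2_inner M (g k) h)"
  using assms
proof (induction T rule: infinite_finite_induct)
  case (insert k T)
  then show ?case
    using l2_inner_add_left[of "\<lambda>x. c k * g k x" M "\<lambda>x. \<Sum>k\<in>T. c k * g k x" h]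
    by (simp add: l2_functions_cmult l2_functions_sum l2_inner_cmult_left)
qed (simp_all add: l2_inner_def)

lemma l2_inner_diff_left:
  assumes "f \<in> l2_functions M" "g \<in> l2_functions M" "h \<in> l2_functions M"
  shows "l2_inner M (\<lambda>x. f x - g x) h = l2_inner M f h - l2_inner M g h"
  using assms by (simp add: l2_inner_def left_diff_distrib l2_mult_integrable)

lemma l2_inner_cong:
  "(\<And>x. x \<in> space M \<Longrightarrow> f x = f' x) \<Longrightarrow> (\<And>x. x \<in> space M \<Longrightarrow> g x = g' x) \<Longrightarrow>
    l2_inner M f g = l2_inner M f' g'"
  unfolding l2_inner_def by (intro Bochner_Integration.integral_cong) auto

lemma l2_inner_self_nonneg: "l2_inner M f f \<ge> 0"
  by (simp add: l2_inner_def)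

lemma l2_norm_nonneg: "l2_norm M f \<ge> 0"
  by (simp add: l2_norm_def l2_inner_self_nonneg)

lemma l2_norm_power2: "(l2_norm M f)\<^sup>2 = l2_inner M f f"
  by (simp add: l2_norm_def l2_inner_self_nonneg)

lemma l2_norm_cmult: "l2_norm M (\<lambda>x. c * f x) = \<bar>c\<bar> * l2_norm M f"
proof -
  have "l2_inner M (\<lambda>x. c * f x) (\<lambda>x. c * f x) = c\<^sup>2 * l2_inner M f f"
    by (simp add: l2_inner_def power2_eq_square mult_ac flip: integral_mult_right_zero)
  then show ?thesis by (simp add: l2_norm_def real_sqrt_mult)
qed

text \<open>Pointwise, \<open>(f + g)^2 \<le> 2 * f^2 + 2 * g^2\<close>. A constant factor is
  harmless in the approximation arguments for closed spans.\<close>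

lemma l2_norm_quasi_triangle:
  assumes "f \<in> l2_functions M" "g \<in> l2_functions M"
  shows "l2_norm M (\<lambda>x. f x + g x) \<le> 2 * (l2_norm M f + l2_norm M g)"
proof (rule power2_le_imp_le)
  have i: "integrable M (\<lambda>x. f x * f x)" "integrable M (\<lambda>x. g x * g x)"
    using assms by (auto intro: l2_mult_integrable)
  have "l2_inner M (\<lambda>x. f x + g x) (\<lambda>x. f x + g x) \<le> (\<integral>x. 2 * (f x * f x) + 2 * (g x * g x) \<partial>M)"
    unfolding l2_inner_def
  proof (rule integral_mono)
    show "(f x + g x) * (f x + g x) \<le> 2 * (f x * f x) + 2 * (g x * g x)" for x
      using zero_le_square[of "f x - g x"] by (simp add: algebra_simps)
  qed (use i l2_mult_integrable[OF l2_functions_add[OF assms] l2_functions_add[OF assms]] in auto)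
  also have "\<dots> = 2 * (l2_norm M f)\<^sup>2 + 2 * (l2_norm M g)\<^sup>2"
    using i unfolding l2_norm_power2 by (simp add: l2_inner_def)
  also have "\<dots> \<le> (2 * (l2_norm M f + l2_norm M g))\<^sup>2"
    using l2_norm_nonneg[of M f] l2_norm_nonneg[of M g] by (simp add: power2_sum power_mult_distrib)
  finally show "(l2_norm M (\<lambda>x. f x + g x))\<^sup>2 \<le> (2 * (l2_norm M f + l2_norm M g))\<^sup>2"
    by (simp add: l2_norm_power2)
qed (simp add: l2_norm_nonneg)

section \<open>Linear spans and their closures\<close>

lemma fun_span_l2: "B \<subseteq> l2_functions M \<Longrightarrow> fun_span B \<subseteq> l2_functions M"
  by (auto simp: fun_span_def intro!: l2_functions_sum)

lemma fun_span_add: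
  assumes "f \<in> fun_span B" "g \<in> fun_span B"
  shows "(\<lambda>x. f x + g x) \<in> fun_span B"
proof -
  obtain T c where T: "f = (\<lambda>x. \<Sum>b\<in>T. c b * b x)" "finite T" "T \<subseteq> B"
    using assms(1) by (auto simp: fun_span_def)
  obtain S d where S: "g = (\<lambda>x. \<Sum>b\<in>S. d b * b x)" "finite S" "S \<subseteq> B"
    using assms(2) by (auto simp: fun_span_def)
  let ?e = "\<lambda>b. (if b \<in> T then c b else 0) + (if b \<in> S then d b else 0)"
  have "f x + g x = (\<Sum>b\<in>T \<union> S. ?e b * b x)" for x
  proof -
    have "f x = (\<Sum>b\<in>T \<union> S. (if b \<in> T then c b else 0) * b x)"
      unfolding T(1) using T(2) S(2) by (intro sum.mono_neutral_cong_left) auto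
    moreover have "g x = (\<Sum>b\<in>T \<union> S. (if b \<in> S then d b else 0) * b x)"
      unfolding S(1) using T(2) S(2) by (intro sum.mono_neutral_cong_left) auto
    ultimately show ?thesis by (simp only: distrib_right sum.distrib)
  qed
  then show ?thesis using T S unfolding fun_span_def
    by (intro CollectI exI[of _ "T \<union> S"] exI[of _ ?e]) auto
qed

lemma fun_span_cmult:
  assumes "f \<in> fun_span B"
  shows "(\<lambda>x. a * f x) \<in> fun_span B"
proof -
  obtain T c where "f = (\<lambda>x. \<Sum>b\<in>T. c b * b x)" "finite T" "T \<subseteq> B"
    using assms(1) by (auto simp: fun_span_def)
  then show ?thesis unfolding fun_span_def
    by (intro CollectI exI[of _ T] exI[of _ "\<lambda>b. a * c b"]) (auto simp: sum_distrib_left mult.assoc)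
qed

lemma fun_span_zero: "(\<lambda>x. 0) \<in> fun_span B"
  unfolding fun_span_def by (intro CollectI exI[of _ "{}"]) auto

lemma l2_closed_spanD:
  assumes "f \<in> l2_closed_span M B" "e > 0"
  obtains g where "g \<in> fun_span B" "l2_norm M (\<lambda>x. f x - g x) < e"
  using assms by (auto simp: l2_closed_span_def)

lemma l2_closed_subspace_closed_span:
  assumes B: "B \<subseteq> l2_functions M"
  shows "l2_closed_subspace M (l2_closed_span M B)"
  unfolding l2_closed_subspace_def
proof (intro conjI ballI allI impI)
  have sub: "l2_closed_span M B \<subseteq> l2_functions M" by (auto simp: l2_closed_span_def)
  then show "l2_closed_span M B \<subseteq> l2_functions M" .
  show "(\<lambda>x. 0) \<in> l2_closed_span M B"
    unfolding l2_closed_span_def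
    by (auto simp: l2_functions_zero l2_norm_def l2_inner_def intro!: bexI[OF _ fun_span_zero])
  note span = fun_span_l2[OF B, THEN subsetD]
  \<comment> \<open>The quarters absorb the factor 2 of the quasi-triangle inequality.\<close>
  have approx: "l2_norm M (\<lambda>x. f x + g x) < e"
    if "f \<in> l2_functions M" "g \<in> l2_functions M" "l2_norm M f < e / 4" "l2_norm M g < e / 4" for f g e
  proof (rule le_less_trans[OF l2_norm_quasi_triangle[OF that(1,2)]])
    show "2 * (l2_norm M f + l2_norm M g) < e" using that(3,4) by argo
  qed
  show "(\<lambda>x. f x + g x) \<in> l2_closed_span M B"
    if f: "f \<in> l2_closed_span M B" and g: "g \<in> l2_closed_span M B" for f g
    unfolding l2_closed_span_def
  proof (intro CollectI conjI allI impI)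
    show "(\<lambda>x. f x + g x) \<in> l2_functions M" using f g sub l2_functions_add by blast
    fix e :: real assume "e > 0"
    then obtain f' g' where f': "f' \<in> fun_span B" "l2_norm M (\<lambda>x. f x - f' x) < e / 4"
      and g': "g' \<in> fun_span B" "l2_norm M (\<lambda>x. g x - g' x) < e / 4"
      using l2_closed_spanD[OF f, of "e / 4"] l2_closed_spanD[OF g, of "e / 4"]
      by (metis zero_less_divide_iff zero_less_numeral)
    have "l2_norm M (\<lambda>x. (f x - f' x) + (g x - g' x)) < e"
      using f' g' f g sub span by (intro approx l2_functions_diff) auto
    then show "\<exists>h\<in>fun_span B. l2_norm M (\<lambda>x. f x + g x - h x) < e"
      using fun_span_add[OF f'(1) g'(1)] by (intro bexI[of _ "\<lambda>x. f' x + g' x"]) (simp_all add: algebra_simps)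
  qed
  show "(\<lambda>x. c * f x) \<in> l2_closed_span M B" if f: "f \<in> l2_closed_span M B" for c f
    unfolding l2_closed_span_def
  proof (intro CollectI conjI allI impI)
    show "(\<lambda>x. c * f x) \<in> l2_functions M" using f sub l2_functions_cmult by blast
    fix e :: real assume "e > 0"
    then obtain g where g: "g \<in> fun_span B" "l2_norm M (\<lambda>x. f x - g x) < e / (\<bar>c\<bar> + 1)"
      using l2_closed_spanD[OF f, of "e / (\<bar>c\<bar> + 1)"] by (auto simp: add_nonneg_pos)
    have "l2_norm M (\<lambda>x. c * f x - c * g x) = \<bar>c\<bar> * l2_norm M (\<lambda>x. f x - g x)"
      by (simp flip: right_diff_distrib l2_norm_cmult)
    also have "\<dots> \<le> \<bar>c\<bar> * (e / (\<bar>c\<bar> + 1))" using g(2) by (intro mult_left_mono) auto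
    also have "\<dots> < e" using \<open>e > 0\<close> by (simp add: field_simps)
    finally show "\<exists>h\<in>fun_span B. l2_norm M (\<lambda>x. c * f x - h x) < e"
      using fun_span_cmult[OF g(1), of c] by (rule rev_bexI[rotated])
  qed
  show "f \<in> l2_closed_span M B"
    if f: "f \<in> l2_functions M" "\<forall>e>0. \<exists>g\<in>l2_closed_span M B. l2_norm M (\<lambda>x. f x - g x) < e" for f
    unfolding l2_closed_span_def
  proof (intro CollectI conjI allI impI f)
    fix e :: real assume "e > 0"
    then have e4: "e / 4 > 0" by simp
    obtain g where g: "g \<in> l2_closed_span M B" "l2_norm M (\<lambda>x. f x - g x) < e / 4"
      using f(2) e4 by blast
    obtain h where h: "h \<in> fun_span B" "l2_norm M (\<lambda>x. g x - h x) < e / 4"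
      using l2_closed_spanD[OF g(1) e4] .
    have "l2_norm M (\<lambda>x. (f x - g x) + (g x - h x)) < e"
      using f g h sub span by (intro approx l2_functions_diff) auto
    then show "\<exists>h\<in>fun_span B. l2_norm M (\<lambda>x. f x - h x) < e"
      using h(1) by (intro bexI[of _ h]) simp_all
  qed
qed

section \<open>Gram--Schmidt orthonormalisation\<close>

definition gs_residual :: "'a measure \<Rightarrow> (nat \<Rightarrow> 'a \<Rightarrow> real) \<Rightarrow> nat \<Rightarrow> 'a \<Rightarrow> real" where
  "gs_residual M f j =
    (\<lambda>x. f j x - (\<Sum>k<j. l2_inner M (f j) (gram_schmidt M f k) * gram_schmidt M f k x))"

lemma gram_schmidt_eq:
  "gram_schmidt M f j = (\<lambda>x. (1 / l2_norm M (gs_residual M f j)) * gs_residual M f j x)"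
  by (subst gram_schmidt.simps) (simp add: gs_residual_def Let_def)

lemma gram_schmidt_l2:
  assumes "\<And>k. f k \<in> l2_functions M"
  shows "gram_schmidt M f j \<in> l2_functions M"
proof (induction j rule: less_induct)
  case (less j)
  then have "gs_residual M f j \<in> l2_functions M"
    unfolding gs_residual_def by (intro l2_functions_diff assms l2_functions_sum) auto
  then show ?case unfolding gram_schmidt_eq by (rule l2_functions_cmult)
qed

text \<open>The hypothesis \<open>nz\<close> excludes the default value of division by zero, for
  which the output would be the zero function instead of a unit vector.\<close>

lemma gram_schmidt_orthonormal:
  assumes f: "\<And>k. f k \<in> l2_functions M"
    and nz: "\<And>k. l2_norm M (gs_residual M f k) \<noteq> 0"
  shows "l2_inner M (gram_schmidt M f j) (gram_schmidt M f k) = (if j = k then 1 else 0)"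
proof -
  let ?g = "gram_schmidt M f"
  note g = gram_schmidt_l2[of f M, OF f]
  have unit: "l2_inner M (?g j) (?g j) = 1" for j
  proof -
    let ?v = "gs_residual M f j"
    have "l2_norm M (?g j) = 1"
      unfolding gram_schmidt_eq[of M f j] l2_norm_cmult using nz[of j] l2_norm_nonneg[of M ?v] by simp
    then show ?thesis using l2_norm_power2[of M "?g j"] by simp
  qed
  have orth: "l2_inner M (?g j) (?g k) = 0" if "k < j" for j k
    using that
  proof (induction j arbitrary: k rule: less_induct)
    case (less j)
    have orth: "l2_inner M (?g i) (?g k) = (if i = k then 1 else 0)" if "i < j" for i
      using less.IH[OF that, of k] less.IH[OF less.prems, of i, unfolded l2_inner_commute[of M "?g k"]] unit[of i]
      by (cases i k rule: linorder_cases) auto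
    have "l2_inner M (gs_residual M f j) (?g k) = l2_inner M (f j) (?g k)
      - (\<Sum>i<j. l2_inner M (f j) (?g i) * l2_inner M (?g i) (?g k))"
      unfolding gs_residual_def by (simp add: l2_inner_diff_left l2_inner_sum_left l2_functions_sum f g)
    also have "(\<Sum>i<j. l2_inner M (f j) (?g i) * l2_inner M (?g i) (?g k))
      = (\<Sum>i<j. if i = k then l2_inner M (f j) (?g k) else 0)"
      by (intro sum.cong) (auto simp: orth)
    also have "\<dots> = l2_inner M (f j) (?g k)" using less.prems by simp
    finally show ?case unfolding gram_schmidt_eq[of M f j] l2_inner_cmult_left by simp
  qed
  show ?thesis using unit[of j] orth[of k j] orth[of j k, unfolded l2_inner_commute[of M "?g k"]]
    by (cases j k rule: linorder_cases) auto
qed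

subsection \<open>Orthogonality on the gasket\<close>

context gasket begin

lemma cell_diameter:
  obtains B where "\<And>w x y. x \<in> cell q SG w \<Longrightarrow> y \<in> cell q SG w \<Longrightarrow> dist x y \<le> B / 2 ^ length w"
proof -
  obtain B where B: "\<And>y z. y \<in> SG \<Longrightarrow> z \<in> SG \<Longrightarrow> dist y z \<le> B"
    using compact_imp_bounded[OF compact_SG] diameter_bounded_bound[of SG] by metis
  have "dist x y \<le> B / 2 ^ length w" if "x \<in> cell q SG w" "y \<in> cell q SG w" for w x y
    using that B by (auto simp: cell_def dist_F_word intro!: divide_right_mono)
  then show thesis using that by blast
qed

lemma small_cells:
  assumes "e > 0"
  obtains M where "\<And>w x y. length w \<ge> M \<Longrightarrow> x \<in> cell q SG w \<Longrightarrow> y \<in> cell q SG w \<Longrightarrow> dist x y < e"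
proof -
  obtain B where B: "\<And>w x y. x \<in> cell q SG w \<Longrightarrow> y \<in> cell q SG w \<Longrightarrow> dist x y \<le> B / 2 ^ length w"
    using cell_diameter by blast
  obtain M where M: "\<bar>B\<bar> / e < 2 ^ M" using real_arch_pow[of 2 "\<bar>B\<bar> / e"] by auto
  have "dist x y < e" if "length w \<ge> M" "x \<in> cell q SG w" "y \<in> cell q SG w" for w x y
  proof -
    have "\<bar>B\<bar> / e < 2 ^ length w"
      using less_le_trans[OF M power_increasing[OF that(1), of "2::real"]] by simp
    then have "\<bar>B\<bar> / 2 ^ length w < e" using assms by (simp add: field_simps)
    moreover have "B / 2 ^ length w \<le> \<bar>B\<bar> / 2 ^ length w" by (intro divide_right_mono) auto
    ultimately show ?thesis using B[OF that(2,3)] by linarith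
  qed
  then show thesis using that by blast
qed

end

locale measured_gasket = gasket +
  fixes \<mu> :: "(real^2) measure"
  assumes measure: "gasket_measure q SG \<mu>"
begin

section \<open>The gasket measure and its symmetry\<close>

lemma prob: "prob_space \<mu>" and space_eq: "space \<mu> = SG"
  and sets_eq: "sets \<mu> = sets (restrict_space borel SG)"
  and measure_cell: "measure \<mu> (cell q SG w) = (1/3) ^ length w"
  using measure by (auto simp: gasket_measure_def)

lemma cell_sets: "cell q SG w \<in> sets \<mu>"
  using compact_imp_closed[OF compact_cell[of w]] cell_subset[of w]
  by (auto simp: sets_eq sets_restrict_space image_iff intro!: bexI[of _ "cell q SG w"])

lemma measurable_continuous:
  assumes "continuous_on SG (f :: real^2 \<Rightarrow> real)"
  shows "f \<in> borel_measurable \<mu>"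
  using borel_measurable_continuous_on_restrict[OF assms] measurable_cong_sets[OF sets_eq refl] by blast

lemma integrable_continuous:
  assumes "continuous_on SG (f :: real^2 \<Rightarrow> real)"
  shows "integrable \<mu> f"
proof -
  interpret prob_space \<mu> by (rule prob)
  obtain B where "\<And>x. x \<in> SG \<Longrightarrow> norm (f x) \<le> B"
    using compact_imp_bounded[OF compact_continuous_image[OF assms compact_SG]]
    by (auto simp: bounded_iff)
  then show ?thesis
    by (intro integrable_const_bound[of _ B] measurable_continuous assms AE_I2) (simp add: space_eq)
qed

lemma l2_continuous: "continuous_on SG f \<Longrightarrow> f \<in> l2_functions \<mu>"
  by (intro l2_functionsI measurable_continuous integrable_continuous continuous_intros)

text \<open>By continuity \<open>f\<close> has no zero on some small cell containing
  \<open>x\<close>, and every cell has positive mass.\<close>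

lemma integral_square_pos:
  assumes "continuous_on SG f" "x \<in> SG" "f x \<noteq> 0"
  shows "l2_inner \<mu> f f > 0"
proof -
  interpret prob_space \<mu> by (rule prob)
  have "l2_inner \<mu> f f \<noteq> 0"
  proof
    assume "l2_inner \<mu> f f = 0"
    then have "AE y in \<mu>. f y * f y = 0"
      unfolding l2_inner_def
      by (subst (asm) integral_nonneg_eq_0_iff_AE) (auto intro!: integrable_continuous continuous_intros assms)
    then have ae: "AE y in \<mu>. f y = 0" by simp
    obtain d where d: "d > 0" "\<And>y. y \<in> SG \<Longrightarrow> dist y x < d \<Longrightarrow> dist (f y) (f x) < \<bar>f x\<bar>"
      using assms unfolding continuous_on_iff by (metis zero_less_abs_iff)
    obtain M where M: "\<And>w x y. length w \<ge> M \<Longrightarrow> x \<in> cell q SG w \<Longrightarrow> y \<in> cell q SG w \<Longrightarrow> dist x y < d"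
      using small_cells[OF d(1)] by metis
    obtain w where w: "length w = M" "x \<in> cell q SG w" using SG_in_cell[OF assms(2)] by metis
    have "f y \<noteq> 0" if y: "y \<in> cell q SG w" for y
    proof -
      have "dist (f y) (f x) < \<bar>f x\<bar>"
        using d(2)[of y] M[OF _ y w(2)] w(1) cell_subset[of w] y by auto
      then show ?thesis by (auto simp: dist_real_def)
    qed
    then have "AE y in \<mu>. y \<notin> cell q SG w" using ae by (auto elim: eventually_mono)
    then have "cell q SG w \<in> null_sets \<mu>" using AE_iff_null_sets[OF cell_sets] by blast
    then have "measure \<mu> (cell q SG w) = 0" by (rule measure_eq_0_null_sets)
    then show False by (simp add: measure_cell)
  qed
  then show ?thesis using l2_inner_self_nonneg[of \<mu> f] by linarith
qed

text \<open>The cells of one level cover the gasket and their masses add up to 1, so their overlaps are null.\<close>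

lemma AE_sum_cells: "AE x in \<mu>. (\<Sum>w | length w = m. indicator (cell q SG w) x) = (1::real)"
proof -
  interpret prob_space \<mu> by (rule prob)
  let ?s = "\<lambda>x. \<Sum>w | length w = m. indicator (cell q SG w) x :: real"
  have int: "integrable \<mu> (indicator (cell q SG w) :: _ \<Rightarrow> real)" for w
    using cell_sets by (simp add: integrable_indicator_iff emeasure_eq_measure)
  have ge: "?s x \<ge> 1" if x: "x \<in> SG" for x
  proof -
    obtain w where w: "length w = m" "x \<in> cell q SG w" using SG_in_cell[OF x] by metis
    have "(1::real) = (\<Sum>v\<in>{w}. indicator (cell q SG v) x)" using w by simp
    also have "\<dots> \<le> ?s x" using w by (intro sum_mono2) auto
    finally show ?thesis .
  qed
  have "(\<integral>x. ?s x - 1 \<partial>\<mu>) = (\<Sum>w | length w = m. measure \<mu> (cell q SG w)) - 1"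
    using int cell_subset by (simp add: space_eq Int_absorb2 prob_space[unfolded space_eq])
  also have "\<dots> = 0"
  proof -
    have "(\<Sum>w | length w = m. measure \<mu> (cell q SG w)) = (\<Sum>w::3 list | length w = m. (1/3) ^ m)"
      by (intro sum.cong) (auto simp: measure_cell)
    then show ?thesis by (simp add: card_words power_divide)
  qed
  finally have "AE x in \<mu>. ?s x - 1 = 0"
    using int ge by (subst (asm) integral_nonneg_eq_0_iff_AE) (auto simp: space_eq intro!: AE_I2)
  then show ?thesis by simp
qed

text \<open>One base point \<open>z\<close> serves all cells, and \<open>M\<close> depends on
  \<open>f\<close> and \<open>e\<close> but not on \<open>z\<close>. Because of this uniformity the
  base point may later be moved by a reflection.\<close>

lemma riemann_sum:
  fixes f :: "real^2 \<Rightarrow> real" and e :: real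
  assumes f: "continuous_on SG f" and "e > 0"
  obtains M where "\<And>m z. m \<ge> M \<Longrightarrow> z \<in> SG \<Longrightarrow>
    \<bar>(\<integral>x. f x \<partial>\<mu>) - (1/3) ^ m * (\<Sum>w | length w = m. f (F_word q w z))\<bar> \<le> e"
proof -
  interpret prob_space \<mu> by (rule prob)
  obtain d where d: "d > 0" "\<And>x y. x \<in> SG \<Longrightarrow> y \<in> SG \<Longrightarrow> dist x y < d \<Longrightarrow> dist (f x) (f y) < e"
    using compact_uniformly_continuous[OF f compact_SG] \<open>e > 0\<close> unfolding uniformly_continuous_on_def by metis
  obtain M where M: "\<And>w x y. length w \<ge> M \<Longrightarrow> x \<in> cell q SG w \<Longrightarrow> y \<in> cell q SG w \<Longrightarrow> dist x y < d"
    using small_cells[OF d(1)] by metis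
  show thesis
  proof (rule that[of M])
    fix m z assume m: "m \<ge> M" and z: "z \<in> SG"
    let ?I = "\<lambda>w. indicator (cell q SG w) :: _ \<Rightarrow> real"
    note int = integrable_continuous[OF f]
    have intI: "integrable \<mu> (\<lambda>x. g x * ?I w x)" if "integrable \<mu> g" for w and g :: "_ \<Rightarrow> real"
      using integrable_real_mult_indicator[OF cell_sets that] .
    have "(\<integral>x. f x \<partial>\<mu>) = (\<integral>x. (\<Sum>w | length w = m. f x * ?I w x) \<partial>\<mu>)"
    proof (rule integral_cong_AE)
      show "AE x in \<mu>. f x = (\<Sum>w | length w = m. f x * ?I w x)"
        using AE_sum_cells[of m] by (rule eventually_mono) (simp flip: sum_distrib_left)
    qed (intro borel_measurable_sum borel_measurable_integrable intI int)+
    also have "\<dots> = (\<Sum>w | length w = m. \<integral>x. f x * ?I w x \<partial>\<mu>)"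
      by (intro Bochner_Integration.integral_sum intI int)
    finally have "(\<integral>x. f x \<partial>\<mu>) - (1/3) ^ m * (\<Sum>w | length w = m. f (F_word q w z))
      = (\<Sum>w | length w = m. (\<integral>x. f x * ?I w x \<partial>\<mu>) - (1/3) ^ m * f (F_word q w z))"
      by (simp add: sum_subtractf sum_distrib_left)
    also have "\<bar>\<dots>\<bar> \<le> (\<Sum>w::3 list | length w = m. e * (1/3) ^ m)"
    proof (rule order_trans[OF sum_abs], rule sum_mono)
      fix w :: "3 list" assume "w \<in> {w. length w = m}"
      then have w: "length w = m" by simp
      let ?c = "f (F_word q w z)"
      have I: "(\<integral>x. c * ?I w x \<partial>\<mu>) = c * (1/3) ^ m" for c
        using cell_sets cell_subset[of w] by (simp add: space_eq Int_absorb2 measure_cell w)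
      have "(\<integral>x. f x * ?I w x \<partial>\<mu>) - (1/3) ^ m * ?c = (\<integral>x. (f x - ?c) * ?I w x \<partial>\<mu>)"
        unfolding left_diff_distrib
        by (subst Bochner_Integration.integral_diff) (auto simp only: I mult.commute intro!: intI int integrable_const)
      also have "\<bar>\<dots>\<bar> \<le> (\<integral>x. \<bar>(f x - ?c) * ?I w x\<bar> \<partial>\<mu>)" by (rule integral_abs_bound)
      also have "\<dots> \<le> (\<integral>x. e * ?I w x \<partial>\<mu>)"
      proof (rule integral_mono)
        fix x assume "x \<in> space \<mu>"
        show "\<bar>(f x - ?c) * ?I w x\<bar> \<le> e * ?I w x"
        proof (cases "x \<in> cell q SG w")
          case True
          then have "dist x (F_word q w z) < d"
            using M[OF _ True, of "F_word q w z"] w m z by (simp add: cell_def)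
          then have "dist (f x) ?c < e"
            using d(2)[of x "F_word q w z"] True cell_subset[of w] F_word_SG[OF z] by blast
          with True show ?thesis by (simp add: dist_real_def)
        qed simp
      qed (intro integrable_abs intI Bochner_Integration.integrable_diff int integrable_const)+
      also have "\<dots> = e * (1/3) ^ m" by (rule I)
      finally show "\<bar>(\<integral>x. f x * ?I w x \<partial>\<mu>) - (1/3) ^ m * ?c\<bar> \<le> e * (1/3) ^ m" .
    qed
    also have "\<dots> = e" by (simp add: card_words power_divide)
    finally show "\<bar>(\<integral>x. f x \<partial>\<mu>) - (1/3) ^ m * (\<Sum>w | length w = m. f (F_word q w z))\<bar> \<le> e" .
  qed
qed

text \<open>A reflection permutes the words of length \<open>m\<close> and moves the base point to
  \<open>reflect c z\<close>, so both integrals are approximated by the same Riemann sum.\<close>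

lemma integral_reflect:
  fixes f :: "real^2 \<Rightarrow> real"
  assumes f: "continuous_on SG f"
  shows "(\<integral>x. f (reflect c x) \<partial>\<mu>) = (\<integral>x. f x \<partial>\<mu>)"
proof -
  have f': "continuous_on SG (\<lambda>x. f (reflect c x))"
    using reflect_SG by (auto intro!: continuous_on_compose2[OF f continuous_reflect])
  have "\<bar>(\<integral>x. f (reflect c x) \<partial>\<mu>) - (\<integral>x. f x \<partial>\<mu>)\<bar> \<le> e" if "e > 0" for e
  proof -
    from that have e2: "e / 2 > 0" by simp
    obtain M where M: "\<And>m z. m \<ge> M \<Longrightarrow> z \<in> SG \<Longrightarrow>
      \<bar>(\<integral>x. f x \<partial>\<mu>) - (1/3) ^ m * (\<Sum>w | length w = m. f (F_word q w z))\<bar> \<le> e / 2"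
      using riemann_sum[OF f e2] by metis
    obtain M' where M': "\<And>m z. m \<ge> M' \<Longrightarrow> z \<in> SG \<Longrightarrow>
      \<bar>(\<integral>x. f (reflect c x) \<partial>\<mu>) - (1/3) ^ m * (\<Sum>w | length w = m. f (reflect c (F_word q w z)))\<bar> \<le> e / 2"
      using riemann_sum[OF f' e2] by metis
    define m where "m = max M M'"
    obtain z where z: "z \<in> SG" using SG_nonempty by blast
    have "(\<Sum>w | length w = m. f (reflect c (F_word q w z))) = (\<Sum>w | length w = m. f (F_word q w (reflect c z)))"
      by (rule sum.reindex_bij_witness[of _ "map (\<lambda>i. c - i)" "map (\<lambda>i. c - i)"])
        (auto simp: reflect_F_word comp_def)
    then have "\<bar>(\<integral>x. f (reflect c x) \<partial>\<mu>) - (1/3) ^ m * (\<Sum>w | length w = m. f (F_word q w (reflect c z)))\<bar> \<le> e / 2"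
      using M'[OF _ z, of m] by (simp add: m_def)
    moreover have "\<bar>(\<integral>x. f x \<partial>\<mu>) - (1/3) ^ m * (\<Sum>w | length w = m. f (F_word q w (reflect c z)))\<bar> \<le> e / 2"
      using M[OF _ reflect_SG[OF z, of c], of m] by (simp add: m_def)
    moreover have "\<bar>a - b\<bar> \<le> e" if "\<bar>a - r\<bar> \<le> e / 2" "\<bar>b - r\<bar> \<le> e / 2" for a b r :: real
      using that by linarith
    ultimately show ?thesis by blast
  qed
  then have "\<bar>(\<integral>x. f (reflect c x) \<partial>\<mu>) - (\<integral>x. f x \<partial>\<mu>)\<bar> \<le> 0" by (metis field_le_epsilon add_0)
  then show ?thesis by simp
qed

lemma l2_inner_reflect:
  assumes "continuous_on SG f" "continuous_on SG g"
    and "\<And>x. x \<in> SG \<Longrightarrow> f' x = s * f (reflect c x)" "\<And>x. x \<in> SG \<Longrightarrow> g' x = t * g (reflect c x)"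
  shows "l2_inner \<mu> f' g' = s * t * l2_inner \<mu> f g"
proof -
  have "l2_inner \<mu> f' g' = l2_inner \<mu> (\<lambda>x. s * f (reflect c x)) (\<lambda>x. t * g (reflect c x))"
    by (rule l2_inner_cong) (simp_all add: space_eq assms)
  also have "\<dots> = (\<integral>x. s * t * (f (reflect c x) * g (reflect c x)) \<partial>\<mu>)"
    by (simp add: l2_inner_def mult_ac)
  also have "\<dots> = s * t * (\<integral>x. f x * g x \<partial>\<mu>)"
    using integral_reflect[of "\<lambda>x. f x * g x"] assms(1,2) by (simp add: continuous_on_mult)
  finally show ?thesis by (simp add: l2_inner_def)
qed

section \<open>Gram--Schmidt on the gasket\<close>

lemma continuous_gram_schmidt:
  assumes "\<And>k. continuous_on SG (f k)"
  shows "continuous_on SG (gram_schmidt \<mu> f j)"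
proof (induction j rule: less_induct)
  case (less j)
  then show ?case
    unfolding gram_schmidt_eq[of \<mu> f j] gs_residual_def by (intro continuous_intros assms) auto
qed

text \<open>Each coefficient is an inner product of two functions that both acquire the sign
  \<open>s\<close>, and \<open>s * s = 1\<close>. Coefficients and norms are thus unchanged, and the
  relation passes through the recursion.\<close>

lemma gram_schmidt_reflect:
  assumes cont: "\<And>k. continuous_on SG (f k)"
    and f': "\<And>k x. x \<in> SG \<Longrightarrow> f' k x = s * f k (reflect c x)"
    and s: "s * s = 1" and x: "x \<in> SG"
  shows "gram_schmidt \<mu> f' j x = s * gram_schmidt \<mu> f j (reflect c x)"
  using x
proof (induction j arbitrary: x rule: less_induct)
  case (less j)
  have "l2_inner \<mu> (f' j) (gram_schmidt \<mu> f' k) = l2_inner \<mu> (f j) (gram_schmidt \<mu> f k)" if "k < j" for k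
    using l2_inner_reflect[OF cont continuous_gram_schmidt[OF cont] f' less.IH[OF that]] s by simp
  then have res: "gs_residual \<mu> f' j x = s * gs_residual \<mu> f j (reflect c x)" if "x \<in> SG" for x
    using less.IH that f' by (simp add: gs_residual_def right_diff_distrib sum_distrib_left mult_ac)
  have cr: "continuous_on SG (gs_residual \<mu> f j)"
    unfolding gs_residual_def by (intro continuous_intros cont continuous_gram_schmidt)
  have "l2_norm \<mu> (gs_residual \<mu> f' j) = l2_norm \<mu> (gs_residual \<mu> f j)"
    unfolding l2_norm_def using l2_inner_reflect[OF cr cr res res] s by simp
  then show ?case
    unfolding gram_schmidt_eq[of \<mu> _ j] using res[OF less.prems] by simp
qed

lemma exact_degree_continuous: "exact_degree j f \<Longrightarrow> continuous_on SG f"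
  by (cases j) (auto simp: has_laplacian_def)

lemma exact_degree_cmult: "exact_degree j f \<Longrightarrow> c \<noteq> 0 \<Longrightarrow> exact_degree j (\<lambda>x. c * f x)"
proof (induction j arbitrary: f)
  case 0
  then obtain g x where g: "has_laplacian q SG f g" "\<forall>x\<in>SG. g x = 0" and x: "x \<in> SG" "f x \<noteq> 0"
    by auto
  have "has_laplacian q SG (\<lambda>x. c * f x) (\<lambda>x. c * g x)" by (rule has_laplacian_cmult[OF g(1)])
  moreover have "\<forall>x\<in>SG. c * g x = 0" "\<exists>x\<in>SG. c * f x \<noteq> 0" using g(2) x \<open>c \<noteq> 0\<close> by auto
  ultimately show ?case unfolding exact_degree.simps by blast
next
  case (Suc j)
  then obtain g where g: "has_laplacian q SG f g" "exact_degree j g" by auto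
  then have "exact_degree j (\<lambda>x. c * g x)" using Suc by blast
  then show ?case using has_laplacian_cmult[OF g(1), of c] unfolding exact_degree.simps by blast
qed

lemma exact_degree_norm: "exact_degree j f \<Longrightarrow> l2_norm \<mu> f \<noteq> 0"
  using exact_degree_nonzero[of j f] exact_degree_continuous[of j f] integral_square_pos[of f]
  by (force simp: l2_norm_def)

text \<open>One induction must carry both functions: the residual at \<open>j\<close> uses the
  degrees of the earlier normalised functions, and normalising keeps the degree only because the
  residual has nonzero norm.\<close>

lemma exact_degree_gram_schmidt:
  assumes "\<And>j. exact_degree j (f j)"
  shows "exact_degree j (gram_schmidt \<mu> f j)" "l2_norm \<mu> (gs_residual \<mu> f j) \<noteq> 0"
proof -
  have "exact_degree j (gs_residual \<mu> f j) \<and> exact_degree j (gram_schmidt \<mu> f j)"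
  proof (induction j rule: less_induct)
    case (less j)
    have "exact_degree j (\<lambda>x. f j x + (\<Sum>k\<in>{..<j}. - l2_inner \<mu> (f j) (gram_schmidt \<mu> f k) * gram_schmidt \<mu> f k x))"
      using less by (intro exact_degree_sum assms) auto
    then have r: "exact_degree j (gs_residual \<mu> f j)"
      by (simp add: gs_residual_def sum_negf)
    moreover have "exact_degree j (gram_schmidt \<mu> f j)"
      unfolding gram_schmidt_eq[of \<mu> f j]
      by (rule exact_degree_cmult[OF r]) (simp add: exact_degree_norm[OF r])
    ultimately show ?case ..
  qed
  then show "exact_degree j (gram_schmidt \<mu> f j)" "l2_norm \<mu> (gs_residual \<mu> f j) \<noteq> 0"
    using exact_degree_norm by blast+
qed

lemma gram_schmidt_exact_degree_orthonormal:
  assumes "\<And>j. exact_degree j (f j)"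
  shows "l2_inner \<mu> (gram_schmidt \<mu> f j) (gram_schmidt \<mu> f k) = (if j = k then 1 else 0)"
  by (intro gram_schmidt_orthonormal l2_continuous exact_degree_continuous[OF assms]
      exact_degree_gram_schmidt(2)[OF assms])

end

section \<open>The orthonormal polynomials\<close>

locale gasket_monomials = measured_gasket +
  fixes P :: "3 \<Rightarrow> nat \<Rightarrow> nat \<Rightarrow> real^2 \<Rightarrow> real"
  assumes monomial: "\<And>n j i. i \<in> {1, 2, 3} \<Longrightarrow> is_monomial q SG n j i (P n j i)"
begin

abbreviation "Q i j \<equiv> antisymmetric_polynomial \<mu> P i j"
abbreviation "S j \<equiv> symmetric_polynomial \<mu> P j"

lemma monomial_1: "is_monomial q SG n j 1 (P n j 1)"
  and monomial_3: "is_monomial q SG n j 3 (P n j 3)"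
  by (simp_all add: monomial)

lemma exact_degree_P: "exact_degree j (P n j 3)"
  by (rule exact_degree_monomial_3[OF monomial_3])

lemma rho_eq: "\<rho> P j = (\<lambda>x. \<Sum>n\<in>UNIV. P n j 1 x)"
  by (simp add: fun_eq_iff \<rho>_def sum_three)

lemma exact_degree_rho: "exact_degree j (\<rho> P j)"
  unfolding rho_eq by (rule exact_degree_sum_monomial_1[OF monomial_1])

lemma continuous_Q: "continuous_on SG (Q i j)"
  unfolding antisymmetric_polynomial_def
  by (intro continuous_gram_schmidt exact_degree_continuous[OF exact_degree_P])

lemma continuous_S: "continuous_on SG (S j)"
  unfolding symmetric_polynomial_def
  by (intro continuous_gram_schmidt exact_degree_continuous[OF exact_degree_rho])

lemma Q_reflect:
  assumes "x \<in> SG" shows "Q (c - i) j x = - Q i j (reflect c x)"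
proof -
  have "P (c - i) k 3 y = - 1 * P i k 3 (reflect c y)" if "y \<in> SG" for k y
    using monomial_3_reflect[OF monomial_3[of i k] monomial_3 that, of c] by simp
  from gram_schmidt_reflect[OF exact_degree_continuous[OF exact_degree_P] this _ assms] show ?thesis
    by (simp add: antisymmetric_polynomial_def)
qed

lemma S_reflect:
  assumes "x \<in> SG" shows "S j x = S j (reflect c x)"
proof -
  have "\<rho> P k y = 1 * \<rho> P k (reflect c y)" if "y \<in> SG" for k y
  proof -
    have "P n k 1 (reflect c y) = P (c - n) k 1 y" for n
      by (rule monomial_1_reflect[OF monomial_1 monomial_1 that])
    then show ?thesis unfolding rho_eq using sum_reflect_index[of "\<lambda>n. P n k 1 y" c] by simp
  qed
  from gram_schmidt_reflect[OF exact_degree_continuous[OF exact_degree_rho] this _ assms] show ?thesis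
    by (simp add: symmetric_polynomial_def)
qed

lemma Q_orthonormal: "l2_inner \<mu> (Q i j) (Q i k) = (if j = k then 1 else 0)"
  unfolding antisymmetric_polynomial_def
  by (rule gram_schmidt_exact_degree_orthonormal) (rule exact_degree_P)

lemma S_orthonormal: "l2_inner \<mu> (S j) (S k) = (if j = k then 1 else 0)"
  unfolding symmetric_polynomial_def
  by (rule gram_schmidt_exact_degree_orthonormal) (rule exact_degree_rho)

text \<open>Under the reflection fixing \<open>q i\<close> the first factor is odd and the second
  even, so the inner product equals its own negative.\<close>

lemma Q_S_orthogonal: "l2_inner \<mu> (Q i j) (S k) = 0"
proof -
  have "l2_inner \<mu> (Q i j) (S k) = - 1 * 1 * l2_inner \<mu> (Q i j) (S k)"
    using Q_reflect[of _ "i + i" i j] S_reflect[of _ k "i + i"]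
    by (intro l2_inner_reflect[where c = "i + i"] continuous_Q continuous_S) auto
  then show ?thesis by simp
qed

text \<open>The relation between the monomials passes to the \<open>Q\<close> because the three
  processes use the same coefficients and norms: up to sign, the one at \<open>n\<close> is the copy
  of the one at 0 under \<open>reflect n\<close>, which exchanges \<open>q 0\<close> and
  \<open>q n\<close>.\<close>

lemma sum_Q: "x \<in> SG \<Longrightarrow> (\<Sum>n\<in>UNIV. Q n j x) = 0"
proof (induction j arbitrary: x rule: less_induct)
  case (less j)
  let ?R = "\<lambda>n. gs_residual \<mu> (\<lambda>j. P n j 3) j"
  let ?a = "\<lambda>k. l2_inner \<mu> (P 0 j 3) (Q 0 k)"
  have P: "P n k 3 y = - 1 * P 0 k 3 (reflect n y)" if "y \<in> SG" for n k y
    using monomial_3_reflect[OF monomial_3[of 0 k] monomial_3 that, of n] by simp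
  have Q: "Q n k y = - 1 * Q 0 k (reflect n y)" if "y \<in> SG" for n k y
    using Q_reflect[OF that, of n 0 k] by simp
  note cP = exact_degree_continuous[OF exact_degree_P]
  have a: "l2_inner \<mu> (P n j 3) (Q n k) = ?a k" for n k
  proof -
    have "l2_inner \<mu> (P n j 3) (Q n k) = - 1 * - 1 * ?a k"
      by (rule l2_inner_reflect[OF cP continuous_Q P Q])
    then show ?thesis by simp
  qed
  have R: "?R n y = P n j 3 y - (\<Sum>k<j. ?a k * Q n k y)" for n y
    using a[of n, unfolded antisymmetric_polynomial_def]
    by (simp only: gs_residual_def antisymmetric_polynomial_def)
  have R': "?R n y = - 1 * ?R 0 (reflect n y)" if "y \<in> SG" for n y
    unfolding R using P[OF that, of n j] Q[OF that, of n] by (simp add: sum_negf)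
  have cR: "continuous_on SG (?R 0)"
    unfolding R[abs_def] by (intro continuous_intros cP continuous_Q)
  have norm: "l2_norm \<mu> (?R n) = l2_norm \<mu> (?R 0)" for n
  proof -
    have "l2_inner \<mu> (?R n) (?R n) = - 1 * - 1 * l2_inner \<mu> (?R 0) (?R 0)"
      by (rule l2_inner_reflect[OF cR cR R' R'])
    then show ?thesis by (simp add: l2_norm_def)
  qed
  have "Q n j x = 1 / l2_norm \<mu> (?R 0) * ?R n x" for n
    by (simp only: antisymmetric_polynomial_def gram_schmidt_eq[of \<mu> _ j] norm[of n])
  then have "(\<Sum>n\<in>UNIV. Q n j x) = (\<Sum>n\<in>UNIV. 1 / l2_norm \<mu> (?R 0) * ?R n x)"
    by (rule sum.cong[OF refl])
  also have "\<dots> = 1 / l2_norm \<mu> (?R 0) * ((\<Sum>n\<in>UNIV. P n j 3 x) - (\<Sum>n\<in>UNIV. \<Sum>k<j. ?a k * Q n k x))"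
    unfolding R by (simp add: sum_distrib_left sum_subtractf right_diff_distrib)
  also have "(\<Sum>n\<in>UNIV. \<Sum>k<j. ?a k * Q n k x) = (\<Sum>k<j. ?a k * (\<Sum>n\<in>UNIV. Q n k x))"
    by (subst sum.swap) (simp add: sum_distrib_left)
  also have "\<dots> = 0" using less by simp
  also have "(\<Sum>n\<in>UNIV. P n j 3 x) = 0"
    using less.prems by (intro sum_monomial_3[OF monomial_3])
  finally show ?case by simp
qed

lemma Q_inner_distinct:
  assumes "i \<noteq> l"
  shows "l2_inner \<mu> (Q i j) (Q l k) = (if j = k then - 1/2 else 0)"
proof -
  obtain t where t: "t \<noteq> i" "t \<noteq> l"
    "\<And>f :: 3 \<Rightarrow> real. (\<Sum>a\<in>UNIV. f a) = f i + f l + f t"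
    using third_index[OF assms] by metis
  have "i + i - l = t"
    using assms t(1,2) three_around[of l i] three_around[of t i] by auto
  then have "l2_inner \<mu> (Q i j) (Q t k) = - 1 * - 1 * l2_inner \<mu> (Q i j) (Q l k)"
    using Q_reflect[of _ "i + i" i j] Q_reflect[of _ "i + i" l k]
    by (intro l2_inner_reflect[where c = "i + i"] continuous_Q) auto
  moreover have "l2_inner \<mu> (\<lambda>x. \<Sum>n\<in>UNIV. 1 * Q n k x) (Q i j) = 0"
    using l2_inner_cong[of \<mu> "\<lambda>x. \<Sum>n\<in>UNIV. 1 * Q n k x" "\<lambda>x. 0" "Q i j" "Q i j"] sum_Q
    by (simp add: space_eq l2_inner_def)
  then have "(\<Sum>n\<in>UNIV. 1 * l2_inner \<mu> (Q n k) (Q i j)) = 0"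
    by (subst (asm) l2_inner_sum_left) (auto intro: l2_continuous continuous_Q)
  \<comment> \<open>The relation \<open>sum_Q\<close>, paired with \<open>Q i j\<close>. The two
    unknown products are equal, so each is minus half of the known one.\<close>
  then have "l2_inner \<mu> (Q i j) (Q i k) + l2_inner \<mu> (Q i j) (Q l k) + l2_inner \<mu> (Q i j) (Q t k) = 0"
    by (simp add: t(3) l2_inner_commute[of \<mu> _ "Q i j"])
  ultimately show ?thesis by (simp add: Q_orthonormal split: if_splits)
qed

lemma phi_l2: "\<phi> \<mu> P i j \<in> l2_functions \<mu>"
  unfolding \<phi>_def[abs_def] by (intro l2_continuous continuous_intros continuous_Q continuous_S)

lemma phi_orthonormal:
  "l2_inner \<mu> (\<phi> \<mu> P i j) (\<phi> \<mu> P l k) = (if j = k \<and> i = l then 1 else 0)"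
proof -
  define a where "a = sqrt (2/3)"
  define b where "b = sqrt (1/3)"
  have ab: "a * a = 2/3" "b * b = 1/3" by (simp_all add: a_def b_def)
  have phi: "\<phi> \<mu> P i j = (\<lambda>x. a * Q i j x + b * S j x)" for i j
    by (simp add: fun_eq_iff \<phi>_def a_def b_def)
  note l2 = l2_continuous[OF continuous_Q] l2_continuous[OF continuous_S]
  have left: "l2_inner \<mu> (\<phi> \<mu> P i j) h = a * l2_inner \<mu> (Q i j) h + b * l2_inner \<mu> (S j) h"
    if "h \<in> l2_functions \<mu>" for i j h
    unfolding phi using that
    by (simp add: l2_inner_add_left l2_functions_cmult l2 l2_inner_cmult_left)
  have "l2_inner \<mu> (\<phi> \<mu> P i j) (\<phi> \<mu> P l k) =
    a * (a * l2_inner \<mu> (Q l k) (Q i j) + b * l2_inner \<mu> (S k) (Q i j)) +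
    b * (a * l2_inner \<mu> (Q l k) (S j) + b * l2_inner \<mu> (S k) (S j))"
  proof -
    have "l2_inner \<mu> h (\<phi> \<mu> P l k) = a * l2_inner \<mu> (Q l k) h + b * l2_inner \<mu> (S k) h"
      if "h \<in> l2_functions \<mu>" for h
      unfolding l2_inner_commute[of \<mu> h "\<phi> \<mu> P l k"] by (rule left[OF that])
    then show ?thesis by (simp only: left[OF phi_l2, of i j l k] l2)
  qed
  also have "\<dots> = (a * a) * l2_inner \<mu> (Q l k) (Q i j) + (b * b) * l2_inner \<mu> (S k) (S j)"
    using Q_S_orthogonal[of i j k] Q_S_orthogonal[of l k j] by (simp add: l2_inner_commute[of \<mu> "S k"])
  also have "\<dots> = (if j = k \<and> i = l then 1 else 0)"
    unfolding ab by (cases "i = l") (simp_all add: Q_orthonormal S_orthonormal Q_inner_distinct)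
  finally show ?thesis .
qed

end

theorem theorem4p2:
  fixes q :: "3 \<Rightarrow> real^2"
    and SG :: "(real^2) set"
    and \<mu> :: "(real^2) measure"
    and P :: "3 \<Rightarrow> nat \<Rightarrow> nat \<Rightarrow> real^2 \<Rightarrow> real"
  assumes "equilateral q"
    and "sierpinski_gasket q SG"
    and "gasket_measure q SG \<mu>"
    and "\<And>n j i. i \<in> {1, 2, 3} \<Longrightarrow> is_monomial q SG n j i (P n j i)"
  shows "\<exists>W. l2_closed_subspace \<mu> W \<and>
           l2_orthonormal_basis \<mu> (\<lambda>(i, j). \<phi> \<mu> P i j) W \<and>
           W = l2_closed_span \<mu> {\<phi> \<mu> P i j | i j. True} \<and>
           (\<forall>i l j k. l2_inner \<mu> (\<phi> \<mu> P i j) (\<phi> \<mu> P l k) = (if j = k \<and> i = l then 1 else 0))"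
proof -
  interpret gasket_monomials q SG \<mu> P
    by unfold_locales (fact assms)+
  have range: "range (\<lambda>(i, j). \<phi> \<mu> P i j) = {\<phi> \<mu> P i j | i j. True}"
    by auto
  have l2: "{\<phi> \<mu> P i j | i j. True} \<subseteq> l2_functions \<mu>"
    using phi_l2 by auto
  have "l2_orthonormal_basis \<mu> (\<lambda>(i, j). \<phi> \<mu> P i j) (l2_closed_span \<mu> {\<phi> \<mu> P i j | i j. True})"
    unfolding l2_orthonormal_basis_def range using l2 by (auto simp: phi_orthonormal)
  then show ?thesis
    using l2_closed_subspace_closed_span[OF l2] phi_orthonormal by blast
qed

end
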